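(* WSR-MM+ for MIMO beamforming is a projected gradient ascent step. Precisely: let $\{\underline{\mathbf{W}}_i\}\in\mathcal{W}$, $\mathbf{S}_k=\sum_{j=1}^{K}\omega_j\mathbf{H}_{j,k}^{\mathsf{H}}\mathbf{A}_j\mathbf{H}_{j,k}$, let $\eta_k>0$ with $\eta_k\ge\lambda_{\max}(\mathbf{S}_k)$, and let $$\mathbf{Q}_k=\eta_k^{-1}\Bigl(\omega_k\mathbf{H}_{k,k}^{\mathsf{H}}\mathbf{B}_k^{\mathsf{H}}-(\mathbf{S}_k-\eta_k\mathbf{I})\underline{\mathbf{W}}_k\Bigr),\qquad k=1,\dots,K.$$ Then $$\mathbf{Q}_k=\underline{\mathbf{W}}_k+\frac{1}{2\eta_k}\frac{\partial f(\{\underline{\mathbf{W}}_i\})}{\partial\mathbf{W}_k},$$ and hence the WSR-MM+ update, i.e. the minimizer of $\sum_{k=1}^{K}\eta_k\|\mathbf{W}_k-\mathbf{Q}_k\|^2$ over $\{\mathbf{W}_i\}\in\mathcal{W}$, is the projected gradient ascent step with step sizes $\frac{1}{2\eta_k}$: its $k$-th block is $$\mathbf{W}_k=\mathrm{Proj}_{\mathcal{W}}\Bigl(\underline{\mathbf{W}}_k+\frac{1}{2\eta_k}\frac{\partial f(\{\underline{\mathbf{W}}_i\})}{\partial\mathbf{W}_k}\Bigr).$$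
   Context: Setting: $K$ links; $\mathbf{H}_{i,j}\in\mathbb{C}^{M_i^{\mathsf r}\times M_j^{\mathsf t}}$ is the channel from transmitter $j$ to receiver $i$; $\mathbf{W}_k\in\mathbb{C}^{M_k^{\mathsf t}\times M_k^{\mathsf s}}$ is the beamformer of link $k$; $\sigma_k^2>0$, weights $\omega_k>0$, power budgets $P_k>0$. $\mathbf{F}_k=\sum_{j\ne k}\mathbf{H}_{k,j}\mathbf{W}_j\mathbf{W}_j^{\mathsf{H}}\mathbf{H}_{k,j}^{\mathsf{H}}+\sigma_k^2\mathbf{I}$ and $f(\{\mathbf{W}_i\})=\sum_{k=1}^{K}\omega_k\log\det(\mathbf{I}+\mathbf{W}_k^{\mathsf{H}}\mathbf{H}_{k,k}^{\mathsf{H}}\mathbf{F}_k^{-1}\mathbf{H}_{k,k}\mathbf{W}_k)$ (natural logarithm). $\mathcal{W}=\{\{\mathbf{W}_i\}:\|\mathbf{W}_i\|^2\le P_i,\ i=1,\dots,K\}$, with $\|\cdot\|$ the Frobenius norm. Since $\mathcal{W}$ is a product of balls, the Euclidean projection $\mathrm{Proj}_{\mathcal{W}}$ acts blockwise, the $k$-th block being projected onto $\{\mathbf{W}_k:\|\mathbf{W}_k\|^2\le P_k\}$. $\underline{\mathbf{F}}_k$ is $\mathbf{F}_k$ at $\{\underline{\mathbf{W}}_i\}$, $\mathbf{B}_k=\underline{\mathbf{W}}_k^{\mathsf{H}}\mathbf{H}_{k,k}^{\mathsf{H}}\underline{\mathbf{F}}_k^{-1}$, $\mathbf{A}_k=(\underline{\mathbf{F}}_k+\mathbf{H}_{k,k}\underline{\mathbf{W}}_k\underline{\mathbf{W}}_k^{\mathsf{H}}\mathbf{H}_{k,k}^{\mathsf{H}})^{-1}\mathbf{H}_{k,k}\underline{\mathbf{W}}_k\mathbf{B}_k$.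 Gradient convention: $\partial f/\partial\mathbf{W}_k$ is the matrix $\mathbf{G}_k$ of the same size as $\mathbf{W}_k$ such that the first-order variation of $f$ in direction $\boldsymbol{\Delta}$ of the block $\mathbf{W}_k$ is $\mathrm{Re}\,\mathrm{tr}(\mathbf{G}_k^{\mathsf{H}}\boldsymbol{\Delta})$ (i.e. twice the Wirtinger derivative with respect to the conjugate of $\mathbf{W}_k$). *)

theory Defs
  imports
    "Jordan_Normal_Form.Gauss_Jordan_Elimination"
    "Jordan_Normal_Form.Schur_Decomposition"
    "Jordan_Normal_Form.Spectral_Radius"
    "HOL-Library.FuncSet"
begin

text \<open>
  The matrix sizes depend on the link, so matrices are those of Jordan_Normal_Form.
  Links are the elements of \<open>{1..K}\<close>; link \<open>k\<close> has \<open>Mr k\<close> receive antennas, \<open>Mt k\<close> transmit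
  antennas and \<open>Ms k\<close> streams. A family of matrices is a function on \<open>nat\<close>.
\<close>

section \<open>Matrices\<close>

abbreviation herm :: "complex mat \<Rightarrow> complex mat" ("_\<^sup>H" [1000] 999)
  where "A\<^sup>H \<equiv> mat_adjoint A"

text \<open>Only meaningful for invertible matrices.\<close>

definition minv :: "complex mat \<Rightarrow> complex mat"
  where "minv A = the (mat_inverse A)"

definition mtrace :: "complex mat \<Rightarrow> complex"
  where "mtrace A = (\<Sum>i<dim_row A. A $$ (i, i))"

definition frob :: "complex mat \<Rightarrow> real"
  where "frob A = sqrt (\<Sum>i<dim_row A. \<Sum>j<dim_col A. (cmod (A $$ (i, j)))\<^sup>2)"

definition msum :: "nat \<Rightarrow> nat \<Rightarrow> (nat \<Rightarrow> complex mat) \<Rightarrow> nat set \<Rightarrow> complex mat"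
  where "msum m n A J = mat m n (\<lambda>ij. \<Sum>j\<in>J. A j $$ ij)"

text \<open>Meant for Hermitian matrices of positive size, whose spectrum is real and nonempty.\<close>

definition lambda_max :: "complex mat \<Rightarrow> real"
  where "lambda_max A = Max (Re ` spectrum A)"

section \<open>Weighted sum rate\<close>

definition F_mat ::
  "nat \<Rightarrow> (nat \<Rightarrow> nat) \<Rightarrow> (nat \<Rightarrow> nat \<Rightarrow> complex mat) \<Rightarrow> (nat \<Rightarrow> real) \<Rightarrow>
    (nat \<Rightarrow> complex mat) \<Rightarrow> nat \<Rightarrow> complex mat"
  where "F_mat K Mr H \<sigma> W k =
    msum (Mr k) (Mr k) (\<lambda>j. H k j * W j * (W j)\<^sup>H * (H k j)\<^sup>H) ({1..K} - {k})
      + complex_of_real ((\<sigma> k)\<^sup>2) \<cdot>\<^sub>m 1\<^sub>m (Mr k)"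

text \<open>
  The determinants below are of Hermitian positive definite matrices, hence positive reals;
  \<open>Re\<close> only changes the type.
\<close>

definition wsr ::
  "nat \<Rightarrow> (nat \<Rightarrow> nat) \<Rightarrow> (nat \<Rightarrow> nat) \<Rightarrow> (nat \<Rightarrow> nat \<Rightarrow> complex mat) \<Rightarrow> (nat \<Rightarrow> real) \<Rightarrow>
    (nat \<Rightarrow> real) \<Rightarrow> (nat \<Rightarrow> complex mat) \<Rightarrow> real"
  where "wsr K Mr Ms H \<sigma> \<omega> W =
    (\<Sum>k=1..K. \<omega> k * ln (Re (det
      (1\<^sub>m (Ms k) + (W k)\<^sup>H * (H k k)\<^sup>H * minv (F_mat K Mr H \<sigma> W k) * H k k * W k))))"

definition B_mat ::
  "nat \<Rightarrow> (nat \<Rightarrow> nat) \<Rightarrow> (nat \<Rightarrow> nat \<Rightarrow> complex mat) \<Rightarrow> (nat \<Rightarrow> real) \<Rightarrow>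
    (nat \<Rightarrow> complex mat) \<Rightarrow> nat \<Rightarrow> complex mat"
  where "B_mat K Mr H \<sigma> W k = (W k)\<^sup>H * (H k k)\<^sup>H * minv (F_mat K Mr H \<sigma> W k)"

definition A_mat ::
  "nat \<Rightarrow> (nat \<Rightarrow> nat) \<Rightarrow> (nat \<Rightarrow> nat \<Rightarrow> complex mat) \<Rightarrow> (nat \<Rightarrow> real) \<Rightarrow>
    (nat \<Rightarrow> complex mat) \<Rightarrow> nat \<Rightarrow> complex mat"
  where "A_mat K Mr H \<sigma> W k =
    minv (F_mat K Mr H \<sigma> W k + H k k * W k * (W k)\<^sup>H * (H k k)\<^sup>H)
      * H k k * W k * B_mat K Mr H \<sigma> W k"

definition S_mat ::
  "nat \<Rightarrow> (nat \<Rightarrow> nat) \<Rightarrow> (nat \<Rightarrow> nat) \<Rightarrow> (nat \<Rightarrow> nat \<Rightarrow> complex mat) \<Rightarrow> (nat \<Rightarrow> real) \<Rightarrow>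
    (nat \<Rightarrow> real) \<Rightarrow> (nat \<Rightarrow> complex mat) \<Rightarrow> nat \<Rightarrow> complex mat"
  where "S_mat K Mr Mt H \<sigma> \<omega> W k =
    msum (Mt k) (Mt k)
      (\<lambda>j. complex_of_real (\<omega> j) \<cdot>\<^sub>m ((H j k)\<^sup>H * A_mat K Mr H \<sigma> W j * H j k)) {1..K}"

section \<open>Gradients with respect to a block\<close>

text \<open>
  The real gradient for the inner product \<open>Re (tr (G\<^sup>H \<Delta>))\<close>, that is, twice the Wirtinger
  derivative with respect to the conjugate of the block.
\<close>

definition has_block_gradient ::
  "((nat \<Rightarrow> complex mat) \<Rightarrow> real) \<Rightarrow> (nat \<Rightarrow> complex mat) \<Rightarrow> nat \<Rightarrow> complex mat \<Rightarrow> bool"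
  where "has_block_gradient f W k G \<longleftrightarrow>
    G \<in> carrier_mat (dim_row (W k)) (dim_col (W k)) \<and>
    (\<forall>\<Delta> \<in> carrier_mat (dim_row (W k)) (dim_col (W k)).
      ((\<lambda>t. f (W(k := W k + complex_of_real t \<cdot>\<^sub>m \<Delta>)))
        has_real_derivative Re (mtrace (G\<^sup>H * \<Delta>))) (at 0))"

definition block_gradient ::
  "((nat \<Rightarrow> complex mat) \<Rightarrow> real) \<Rightarrow> (nat \<Rightarrow> complex mat) \<Rightarrow> nat \<Rightarrow> complex mat"
  where "block_gradient f W k = (THE G. has_block_gradient f W k G)"

section \<open>Feasible set and projections\<close>

definition power_ball :: "nat \<Rightarrow> nat \<Rightarrow> real \<Rightarrow> complex mat set"
  where "power_ball m n p = {X \<in> carrier_mat m n. (frob X)\<^sup>2 \<le> p}"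

text \<open>Extensional functions, so that a feasible family is determined by its blocks.\<close>

definition feasible ::
  "nat \<Rightarrow> (nat \<Rightarrow> nat) \<Rightarrow> (nat \<Rightarrow> nat) \<Rightarrow> (nat \<Rightarrow> real) \<Rightarrow> (nat \<Rightarrow> complex mat) set"
  where "feasible K Mt Ms P = (\<Pi>\<^sub>E k\<in>{1..K}. power_ball (Mt k) (Ms k) (P k))"

definition proj_mat :: "complex mat set \<Rightarrow> complex mat \<Rightarrow> complex mat"
  where "proj_mat C X = arg_min (\<lambda>Y. frob (Y - X)) (\<lambda>Y. Y \<in> C)"

definition proj_family ::
  "nat \<Rightarrow> (nat \<Rightarrow> complex mat) set \<Rightarrow> (nat \<Rightarrow> complex mat) \<Rightarrow> (nat \<Rightarrow> complex mat)"
  where "proj_family K C X = arg_min (\<lambda>Y. sqrt (\<Sum>k=1..K. (frob (Y k - X k))\<^sup>2)) (\<lambda>Y. Y \<in> C)"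

end

theory Submission
  imports Defs
begin

text \<open>
  Let \<open>T j\<close> be \<open>F j\<close> plus the covariance of the useful signal at receiver \<open>j\<close>. By Sylvester's
  identity the rate of link \<open>j\<close> is \<open>ln (det (T j)) - ln (det (F j))\<close>, and both covariances depend on
  the block \<open>W k\<close> through a single summand \<open>(H j k * W k) * (H j k * W k)\<^sup>H\<close> (with \<open>F k\<close> not
  depending on it at all). Jacobi's formula gives the gradient of each \<open>ln det\<close>, and since
  \<open>A j = minv (F j) - minv (T j)\<close>, the terms add up to twice
  \<open>\<omega> k \<cdot>\<^sub>m ((H k k)\<^sup>H * (B k)\<^sup>H) - S k * W k\<close>. The update then decouples: the obtuse angle
  criterion shows that the blockwise projections are the only minimizer, whatever the positive weights.
\<close>

section \<open>Adjoints and traces\<close>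

lemma dim_herm [simp]: "dim_row (A\<^sup>H) = dim_col A" "dim_col (A\<^sup>H) = dim_row A"
  by (auto simp: mat_adjoint_def)

lemma herm_carrier [simp, intro]: "A \<in> carrier_mat m n \<Longrightarrow> A\<^sup>H \<in> carrier_mat n m"
  by auto

lemma index_herm [simp]:
  assumes "i < dim_col A" "j < dim_row A"
  shows "A\<^sup>H $$ (i, j) = cnj (A $$ (j, i))"
  using assms by (simp add: mat_adjoint_def mat_of_rows_def)

lemma herm_herm [simp]: "(A\<^sup>H)\<^sup>H = A"
  by (rule eq_matI) auto

lemma herm_add:
  assumes "A \<in> carrier_mat m n" "B \<in> carrier_mat m n"
  shows "(A + B)\<^sup>H = A\<^sup>H + B\<^sup>H"
  by (rule eq_matI) (use assms in auto)

lemma herm_smult_one: "(complex_of_real c \<cdot>\<^sub>m 1\<^sub>m n)\<^sup>H = complex_of_real c \<cdot>\<^sub>m 1\<^sub>m n"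
  by (rule eq_matI) auto

text \<open>Plain sums over \<open>{..<n}\<close> combine directly with \<open>sum.swap\<close>,
  unlike the scalar products that \<open>index_mult_mat(1)\<close> produces; hence that simp rule is
  often deleted below.\<close>

lemma index_mult_sum:
  assumes "i < dim_row A" "j < dim_col B" "dim_col A = dim_row B"
  shows "(A * B) $$ (i, j) = (\<Sum>k<dim_row B. A $$ (i, k) * B $$ (k, j))"
  using assms by (auto simp: scalar_prod_def atLeast0LessThan intro!: sum.cong)

lemma herm_mult:
  assumes "A \<in> carrier_mat m n" "B \<in> carrier_mat n p"
  shows "(A * B)\<^sup>H = B\<^sup>H * A\<^sup>H"
  by (rule eq_matI) (use assms in \<open>auto simp: index_mult_sum mult.commute simp del: index_mult_mat(1)\<close>)

lemma mtrace_mult: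
  assumes "A \<in> carrier_mat m n" "B \<in> carrier_mat n m"
  shows "mtrace (A * B) = (\<Sum>i<m. \<Sum>k<n. A $$ (i, k) * B $$ (k, i))"
  using assms by (simp add: mtrace_def index_mult_sum del: index_mult_mat(1))

lemma mtrace_comm:
  assumes "A \<in> carrier_mat m n" "B \<in> carrier_mat n m"
  shows "mtrace (A * B) = mtrace (B * A)"
proof -
  have "mtrace (A * B) = (\<Sum>k<n. \<Sum>i<m. A $$ (i, k) * B $$ (k, i))"
    unfolding mtrace_mult[OF assms] by (rule sum.swap)
  then show ?thesis
    unfolding mtrace_mult[OF assms(2,1)] by (simp add: mult.commute)
qed

lemma mtrace_herm: "A \<in> carrier_mat n n \<Longrightarrow> mtrace (A\<^sup>H) = cnj (mtrace A)"
  by (auto simp: mtrace_def)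

lemma mtrace_add:
  "A \<in> carrier_mat n n \<Longrightarrow> B \<in> carrier_mat n n \<Longrightarrow> mtrace (A + B) = mtrace A + mtrace B"
  by (auto simp: mtrace_def sum.distrib)

lemma frob_sq:
  "A \<in> carrier_mat m n \<Longrightarrow> (frob A)\<^sup>2 = (\<Sum>i<m. \<Sum>j<n. (cmod (A $$ (i, j)))\<^sup>2)"
  by (auto simp: frob_def sum_nonneg)

lemma frob_nonneg [simp]: "0 \<le> frob A"
  by (auto simp: frob_def intro!: sum_nonneg)

lemma frob_eq_0D:
  assumes A: "A \<in> carrier_mat m n" and 0: "frob A = 0"
  shows "A = 0\<^sub>m m n"
proof (rule eq_matI)
  have "(\<Sum>i<m. \<Sum>j<n. (cmod (A $$ (i, j)))\<^sup>2) = 0"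
    using frob_sq[OF A] 0 by simp
  then have "\<forall>i<m. \<forall>j<n. A $$ (i, j) = 0"
    by (subst (asm) sum_nonneg_eq_0_iff; force simp: sum_nonneg_eq_0_iff intro!: sum_nonneg)
  then show "\<And>i j. i < dim_row (0\<^sub>m m n) \<Longrightarrow> j < dim_col (0\<^sub>m m n) \<Longrightarrow> A $$ (i, j) = 0\<^sub>m m n $$ (i, j)"
    by simp
qed (use A in auto)

lemma mtrace_herm_mult_self:
  assumes "A \<in> carrier_mat m n"
  shows "Re (mtrace (A\<^sup>H * A)) = (frob A)\<^sup>2"
proof -
  \<comment> \<open>The product is turned around first, so that the double sum runs in the order of
    \<open>frob_sq\<close>; \<open>mtrace_comm\<close> turns it back.\<close>
  have "mtrace (A * A\<^sup>H) = (\<Sum>i<m. \<Sum>k<n. complex_of_real ((cmod (A $$ (i, k)))\<^sup>2))"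
    using assms by (auto simp: mtrace_mult[OF assms herm_carrier[OF assms]] complex_norm_square simp del: of_real_power intro!: sum.cong)
  then have "mtrace (A * A\<^sup>H) = complex_of_real ((frob A)\<^sup>2)"
    by (simp add: frob_sq[OF assms])
  then show ?thesis
    by (simp add: mtrace_comm[OF herm_carrier[OF assms] assms])
qed

section \<open>Determinants\<close>

text \<open>Sylvester's identity. \<open>M * N\<close> and \<open>N * M\<close> have equal
  determinants and are both block lower triangular, each with one side of the claim as its only
  nontrivial diagonal block.\<close>

lemma det_one_add_mult_comm:
  fixes A B :: "complex mat"
  assumes A: "A \<in> carrier_mat m n" and B: "B \<in> carrier_mat n m"
  shows "det (1\<^sub>m m + A * B) = det (1\<^sub>m n + B * A)"
proof -
  define M where "M = four_block_mat (1\<^sub>m n) (- B) A (1\<^sub>m m)"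
  define N where "N = four_block_mat (1\<^sub>m n) B (0\<^sub>m m n) (1\<^sub>m m)"
  have carr: "M \<in> carrier_mat (n + m) (n + m)" "N \<in> carrier_mat (n + m) (n + m)"
    unfolding M_def N_def by auto
  have uB: "- B \<in> carrier_mat n m" using B by auto
  have detN: "det N = 1"
    unfolding N_def by (subst det_four_block_mat_lower_left_zero[of _ n _ m]) (use B in auto)
  have MN: "M * N = four_block_mat (1\<^sub>m n) (0\<^sub>m n m) A (1\<^sub>m m + A * B)"
    unfolding M_def N_def
    by (subst mult_four_block_mat[of _ n n _ m _ m _ _ n _ m])
      (use A B uB in \<open>auto simp: comm_add_mat[of _ m m] intro!: cong_four_block_mat\<close>)
  have NM: "N * M = four_block_mat (1\<^sub>m n + B * A) (0\<^sub>m n m) A (1\<^sub>m m)"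
    unfolding M_def N_def
    by (subst mult_four_block_mat[of _ n n _ m _ m _ _ n _ m])
      (use A B uB in \<open>auto intro!: cong_four_block_mat\<close>)
  have "det (M * N) = det (1\<^sub>m m + A * B)"
    unfolding MN by (subst det_four_block_mat_upper_right_zero[of _ n _ m]) (use A B in auto)
  moreover have "det (N * M) = det (1\<^sub>m n + B * A)"
    unfolding NM by (subst det_four_block_mat_upper_right_zero[of _ n _ m]) (use A B in auto)
  ultimately show ?thesis
    using det_mult[OF carr] det_mult[OF carr(2,1)] by (simp add: mult.commute)
qed

text \<open>A nonzero determinant makes \<open>A\<close> a unit of the matrix ring, so
  \<open>mat_inverse\<close> returns \<open>Some\<close> and \<open>the\<close> in
  \<open>minv\<close> unwraps a true inverse.\<close>

lemma minv_mult:
  assumes A: "A \<in> carrier_mat n n" and "det A \<noteq> 0"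
  shows "minv A \<in> carrier_mat n n" "A * minv A = 1\<^sub>m n" "minv A * A = 1\<^sub>m n"
proof -
  have "A \<in> Units (ring_mat TYPE(complex) n ())"
    using assms by (simp add: det_non_zero_imp_unit)
  then obtain B where "mat_inverse A = Some B"
    using mat_inverse(1)[OF A, of "()"] by (cases "mat_inverse A") auto
  then show "minv A \<in> carrier_mat n n" "A * minv A = 1\<^sub>m n" "minv A * A = 1\<^sub>m n"
    using mat_inverse(2)[OF A] by (auto simp: minv_def)
qed

text \<open>The adjoint of the inverse is a left inverse of the adjoint, hence of \<open>A\<close>,
  and a left inverse agrees with the right inverse \<open>minv A\<close>.\<close>

lemma minv_hermitian:
  assumes A: "A \<in> carrier_mat n n" and "det A \<noteq> 0" and herm: "A\<^sup>H = A"
  shows "(minv A)\<^sup>H = minv A"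
proof -
  note I = minv_mult[OF assms(1,2)]
  have "(minv A)\<^sup>H * A = (A\<^sup>H * minv A)\<^sup>H"
    by (simp add: herm_mult[OF herm_carrier[OF A] I(1)])
  also have "\<dots> = 1\<^sub>m n"
    using I herm by (intro eq_matI) auto
  finally have *: "(minv A)\<^sup>H * A = 1\<^sub>m n" .
  have "(minv A)\<^sup>H = (minv A)\<^sup>H * (A * minv A)"
    using I by (metis herm_carrier right_mult_one_mat)
  also have "\<dots> = ((minv A)\<^sup>H * A) * minv A"
    using A I by (simp add: assoc_mult_mat[OF herm_carrier[OF I(1)] A I(1)])
  finally show ?thesis
    using I by (simp add: *)
qed

section \<open>Positive definite matrices\<close>

text \<open>In the order on the complex numbers, \<open>0 < z\<close> includes that \<open>z\<close> is real.\<close>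

definition posdef :: "nat \<Rightarrow> complex mat \<Rightarrow> bool"
  where "posdef n A \<longleftrightarrow> A \<in> carrier_mat n n \<and> A\<^sup>H = A \<and>
    (\<forall>v \<in> carrier_vec n. v \<noteq> 0\<^sub>v n \<longrightarrow> 0 < (A *\<^sub>v v) \<bullet>c v)"

lemma complex_pos_iff: "0 < z \<longleftrightarrow> (\<exists>r>0. z = complex_of_real r)"
  by (auto simp: less_complex_def complex_eq_iff)

text \<open>The characteristic polynomial splits over the complex numbers. Each root is an
  eigenvalue, positive because \<open>(A *\<^sub>v v) \<bullet>c v\<close> is the root times
  \<open>v \<bullet>c v\<close>, and the determinant is the product of the roots.\<close>

lemma posdef_det:
  assumes A: "posdef n A"
  shows "det A = complex_of_real (Re (det A))" "0 < Re (det A)"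
proof -
  have C: "A \<in> carrier_mat n n" using A by (auto simp: posdef_def)
  obtain as where as: "char_poly A = (\<Prod>a\<leftarrow>as. [:- a, 1:])" "length as = n"
    using char_poly_factorized[OF C] by blast
  have pos: "0 < a" if "a \<in> set as" for a
  proof -
    have "poly (char_poly A) a = 0"
      unfolding as(1) by (rule linear_poly_root[OF that])
    then have "eigenvalue A a"
      by (simp add: eigenvalue_root_char_poly[OF C])
    then obtain v where v: "v \<in> carrier_vec n" "v \<noteq> 0\<^sub>v n" "A *\<^sub>v v = a \<cdot>\<^sub>v v"
      using C by (auto simp: eigenvalue_def eigenvector_def)
    have "0 < v \<bullet>c v"
      using conjugate_square_greater_0_vec[OF v(1)] v(2) by simp
    then obtain r where r: "r > 0" "v \<bullet>c v = complex_of_real r"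
      by (auto simp: complex_pos_iff)
    have "0 < (A *\<^sub>v v) \<bullet>c v" using A v by (auto simp: posdef_def)
    then have "0 < a * complex_of_real r" using v r by simp
    then show ?thesis using r by (auto simp: less_complex_def zero_less_mult_iff)
  qed
  have "0 < (\<Prod>a\<leftarrow>as. a)"
    using pos
  proof (induction as)
    case (Cons a as)
    have "0 < a" "0 < (\<Prod>a\<leftarrow>as. a)"
      using Cons by auto
    then show ?case by (simp add: less_complex_def)
  qed (simp add: less_complex_def)
  \<comment> \<open>The characteristic polynomial is evaluated at 0 in two ways; the sign
    \<open>(- 1) ^ n\<close> occurs on both sides and cancels.\<close>
  moreover have "det A = (\<Prod>a\<leftarrow>as. a)"
  proof -
    have ch: "char_matrix A 0 = A"
      by (rule eq_matI) (use C in \<open>auto simp: char_matrix_def\<close>)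
    have "poly (char_poly A) 0 = det (- A)"
      using char_poly_matrix[OF C, of 0] ch by simp
    also have "- A = (- 1) \<cdot>\<^sub>m A"
      by (rule eq_matI) (use C in auto)
    also have "det \<dots> = (- 1) ^ n * det A"
      using C by simp
    finally have "(- 1) ^ n * det A = poly (char_poly A) 0" by simp
    also have "\<dots> = (- 1) ^ length as * (\<Prod>a\<leftarrow>as. a)"
      unfolding as(1) by (induction as) auto
    finally show ?thesis by (simp add: as(2))
  qed
  ultimately show "det A = complex_of_real (Re (det A))" "0 < Re (det A)"
    by (auto simp: less_complex_def complex_eq_iff)
qed

text \<open>White noise alone: the base case for the covariances of
  \<open>posdef_cov\<close>.\<close>

lemma posdef_smult_one:
  assumes "0 < c"
  shows "posdef n (complex_of_real c \<cdot>\<^sub>m 1\<^sub>m n)"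
  unfolding posdef_def
proof (intro conjI ballI impI)
  fix v :: "complex vec" assume v: "v \<in> carrier_vec n" "v \<noteq> 0\<^sub>v n"
  have "complex_of_real c \<cdot>\<^sub>m 1\<^sub>m n *\<^sub>v v = complex_of_real c \<cdot>\<^sub>v v"
    using v by (intro eq_vecI) (auto simp: smult_scalar_prod_distrib[of _ n])
  moreover have "0 < v \<bullet>c v"
    using conjugate_square_greater_0_vec[OF v(1)] v(2) by simp
  ultimately show "0 < (complex_of_real c \<cdot>\<^sub>m 1\<^sub>m n *\<^sub>v v) \<bullet>c v"
    using v assms by (auto simp: less_complex_def)
qed (auto simp: herm_smult_one)

text \<open>Moves a factor to the other side of the Hermitian form, so that the form of
  \<open>X * X\<^sup>H\<close> becomes a squared norm.\<close>

lemma mult_mat_vec_cscalar_prod: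
  assumes A: "A \<in> carrier_mat m n" and v: "v \<in> carrier_vec n" and w: "w \<in> carrier_vec m"
  shows "(A *\<^sub>v v) \<bullet>c w = v \<bullet>c (A\<^sup>H *\<^sub>v w)"
proof -
  have "(A *\<^sub>v v) \<bullet>c w = (\<Sum>i<m. \<Sum>j<n. A $$ (i, j) * v $ j * cnj (w $ i))"
    using assms by (auto simp: scalar_prod_def atLeast0LessThan sum_distrib_right intro!: sum.cong)
  also have "\<dots> = (\<Sum>j<n. \<Sum>i<m. A $$ (i, j) * v $ j * cnj (w $ i))"
    by (rule sum.swap)
  also have "\<dots> = v \<bullet>c (A\<^sup>H *\<^sub>v w)"
    using assms by (auto simp: scalar_prod_def atLeast0LessThan sum_distrib_left mult_ac intro!: sum.cong)
  finally show ?thesis .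
qed

text \<open>The form of \<open>X * X\<^sup>H\<close> at \<open>v\<close> is the squared norm of
  \<open>X\<^sup>H *\<^sub>v v\<close>, so one more received signal does no harm.\<close>

lemma posdef_add_mult_herm:
  assumes A: "posdef n A" and X: "X \<in> carrier_mat n m"
  shows "posdef n (A + X * X\<^sup>H)"
  unfolding posdef_def
proof (intro conjI ballI impI)
  have C: "A \<in> carrier_mat n n" "X * X\<^sup>H \<in> carrier_mat n n" using A X by (auto simp: posdef_def)
  then show "A + X * X\<^sup>H \<in> carrier_mat n n" by auto
  show "(A + X * X\<^sup>H)\<^sup>H = A + X * X\<^sup>H"
    using A herm_add[OF C] herm_mult[OF X herm_carrier[OF X]] by (auto simp: posdef_def)
  fix v :: "complex vec" assume v: "v \<in> carrier_vec n" "v \<noteq> 0\<^sub>v n"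
  have Xv: "X\<^sup>H *\<^sub>v v \<in> carrier_vec m"
    by (rule mult_mat_vec_carrier[OF herm_carrier[OF X] v(1)])
  have "(X * X\<^sup>H *\<^sub>v v) \<bullet>c v = (X\<^sup>H *\<^sub>v v) \<bullet>c (X\<^sup>H *\<^sub>v v)"
    using X v mult_mat_vec_cscalar_prod[OF X Xv v(1)]
    by (simp add: assoc_mult_mat_vec[OF X herm_carrier[OF X] v(1)])
  then have "0 \<le> (X * X\<^sup>H *\<^sub>v v) \<bullet>c v"
    by (simp add: conjugate_square_ge_0_vec)
  moreover have "0 < (A *\<^sub>v v) \<bullet>c v" using A v by (auto simp: posdef_def)
  moreover have "((A + X * X\<^sup>H) *\<^sub>v v) \<bullet>c v = (A *\<^sub>v v) \<bullet>c v + (X * X\<^sup>H *\<^sub>v v) \<bullet>c v"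
    using C v by (simp add: add_mult_distrib_mat_vec add_scalar_prod_distrib[of _ n])
  ultimately show "0 < ((A + X * X\<^sup>H) *\<^sub>v v) \<bullet>c v"
    by (auto simp: less_complex_def less_eq_complex_def)
qed

lemma posdef_minv:
  assumes "posdef n A"
  shows "minv A \<in> carrier_mat n n" "A * minv A = 1\<^sub>m n" "minv A * A = 1\<^sub>m n" "(minv A)\<^sup>H = minv A"
proof -
  have A: "A \<in> carrier_mat n n" "A\<^sup>H = A" using assms by (auto simp: posdef_def)
  have "det A \<noteq> 0" using posdef_det(2)[OF assms] by auto
  then show "minv A \<in> carrier_mat n n" "A * minv A = 1\<^sub>m n" "minv A * A = 1\<^sub>m n" "(minv A)\<^sup>H = minv A"
    using minv_mult[of A n] minv_hermitian[of A n] A by auto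
qed

section \<open>Derivatives\<close>

text \<open>Leibniz expansion: a permutation other than the identity moves at least two indices, so
  after one factor is differentiated a zero off-diagonal entry of \<open>X 0\<close> remains. Only
  the identity survives, and it contributes the trace.\<close>

lemma has_vector_derivative_det_at_one:
  fixes X :: "real \<Rightarrow> complex mat"
  assumes X: "\<And>t. X t \<in> carrier_mat n n" and X0: "X 0 = 1\<^sub>m n"
    and D: "D \<in> carrier_mat n n"
      "\<And>i j. i < n \<Longrightarrow> j < n \<Longrightarrow> ((\<lambda>t. X t $$ (i, j)) has_vector_derivative D $$ (i, j)) (at 0)"
  shows "((\<lambda>t. det (X t)) has_vector_derivative mtrace D) (at 0)"
proof -
  let ?P = "{p. p permutes {0..<n}}"
  \<comment> \<open>Product rule at 0 for the summand of \<open>p\<close>, without its sign: term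
    \<open>i\<close> has the factor of index \<open>i\<close> differentiated.\<close>
  define d where "d p = (\<Sum>i\<in>{0..<n}. D $$ (i, p i) * (\<Prod>j\<in>{0..<n} - {i}. X 0 $$ (j, p j)))" for p
  have summand: "((\<lambda>t. signof p * (\<Prod>i=0..<n. X t $$ (i, p i))) has_vector_derivative signof p * d p) (at 0)"
    if p: "p permutes {0..<n}" for p
  proof -
    have lt: "i < n \<Longrightarrow> p i < n" for i
      using permutes_in_image[OF p, of i] by simp
    have "((\<lambda>t. \<Prod>i\<in>{0..<n}. X t $$ (i, p i)) has_derivative
        (\<lambda>h. \<Sum>i\<in>{0..<n}. (h *\<^sub>R D $$ (i, p i)) * (\<Prod>j\<in>{0..<n} - {i}. X 0 $$ (j, p j)))) (at 0)"
      by (rule has_derivative_prod) (use D(2) lt in \<open>auto simp: has_vector_derivative_def\<close>)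
    then have "((\<lambda>t. \<Prod>i\<in>{0..<n}. X t $$ (i, p i)) has_vector_derivative d p) (at 0)"
      by (simp add: has_vector_derivative_def d_def scaleR_sum_right)
    then show ?thesis
      by (rule has_vector_derivative_mult_right)
  qed
  have "((\<lambda>t. \<Sum>p\<in>?P. signof p * (\<Prod>i=0..<n. X t $$ (i, p i))) has_vector_derivative
      (\<Sum>p\<in>?P. signof p * d p)) (at 0)"
    by (rule has_vector_derivative_sum) (use summand in auto)
  moreover have "(\<Sum>p\<in>?P. signof p * d p) = mtrace D"
  proof -
    have "d p = 0" if p: "p permutes {0..<n}" "p \<noteq> id" for p
    proof -
      \<comment> \<open>If no other factor vanished, \<open>p\<close> would fix every index but
        \<open>i\<close>, and then \<open>i\<close> too by injectivity.\<close>
      have "\<exists>j\<in>{0..<n} - {i}. X 0 $$ (j, p j) = 0" if i: "i \<in> {0..<n}" for i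
      proof (rule ccontr)
        assume none: "\<not> ?thesis"
        then have *: "p j = j" if "j < n" "j \<noteq> i" for j
        proof -
          have "1\<^sub>m n $$ (j, p j) \<noteq> (0 :: complex)"
            using none that X0 by auto
          then show ?thesis
            using that permutes_in_image[OF p(1), of j] by (auto split: if_splits)
        qed
        have "p i = i"
        proof (rule ccontr)
          assume ne: "p i \<noteq> i"
          then have "p (p i) = p i"
            using * permutes_in_image[OF p(1), of i] i by auto
          with ne show False
            using permutes_inj[OF p(1)] by (auto dest: injD)
        qed
        then have "p = id"
          using * permutes_not_in[OF p(1)] by (auto simp: fun_eq_iff)
        with p(2) show False by simp
      qed
      then show ?thesis
        unfolding d_def by (intro sum.neutral ballI) (auto intro!: prod_zero)
    qed
    then have "(\<Sum>p\<in>?P. signof p * d p) = (\<Sum>p\<in>{id}. signof p * d p)"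
      by (intro sum.mono_neutral_right) (auto simp: finite_permutations permutes_id)
    also have "\<dots> = (\<Sum>i\<in>{0..<n}. D $$ (i, i))"
      by (auto simp: d_def X0 intro!: sum.cong)
    finally show ?thesis
      using D(1) by (simp add: mtrace_def atLeast0LessThan)
  qed
  ultimately show ?thesis
    by (simp add: det_def'[OF X])
qed

text \<open>Jacobi's formula, reduced to the case \<open>X 0 = 1\<close> by left multiplication with \<open>minv (X 0)\<close>.\<close>

lemma has_real_derivative_ln_det:
  fixes X :: "real \<Rightarrow> complex mat"
  assumes X: "\<And>t. X t \<in> carrier_mat n n" and X0: "posdef n (X 0)"
    and D: "D \<in> carrier_mat n n"
      "\<And>i j. i < n \<Longrightarrow> j < n \<Longrightarrow> ((\<lambda>t. X t $$ (i, j)) has_vector_derivative D $$ (i, j)) (at 0)"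
  shows "((\<lambda>t. ln (Re (det (X t)))) has_real_derivative Re (mtrace (minv (X 0) * D))) (at 0)"
proof -
  define M where "M = minv (X 0)"
  note inv = posdef_minv[OF X0, folded M_def]
  have "((\<lambda>t. det (M * X t)) has_vector_derivative mtrace (M * D)) (at 0)"
  proof (rule has_vector_derivative_det_at_one)
    fix i j assume ij: "i < n" "j < n"
    have "((\<lambda>t. \<Sum>k<n. M $$ (i, k) * X t $$ (k, j)) has_vector_derivative
        (\<Sum>k<n. M $$ (i, k) * D $$ (k, j))) (at 0)"
      by (intro has_vector_derivative_sum has_vector_derivative_mult_right D(2)) (use ij in auto)
    moreover have "(M * X t) $$ (i, j) = (\<Sum>k<n. M $$ (i, k) * X t $$ (k, j))" for t
      using ij inv(1) X[of t] by (subst index_mult_sum) auto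
    moreover have "(M * D) $$ (i, j) = (\<Sum>k<n. M $$ (i, k) * D $$ (k, j))"
      using ij inv(1) D(1) by (subst index_mult_sum) auto
    ultimately show "((\<lambda>t. (M * X t) $$ (i, j)) has_vector_derivative (M * D) $$ (i, j)) (at 0)"
      by simp
  qed (use inv X D in auto)
  then have "((\<lambda>t. det (X 0) * det (M * X t)) has_vector_derivative det (X 0) * mtrace (M * D)) (at 0)"
    by (rule has_vector_derivative_mult_right)
  moreover have "det (X 0) * det (M * X t) = det (X t)" for t
  proof -
    have "det (X 0) * det M = 1"
      using det_mult[OF X[of 0] inv(1)] inv(2) by simp
    then show ?thesis
      using det_mult[OF inv(1) X[of t]] by simp
  qed
  ultimately have "((\<lambda>t. det (X t)) has_vector_derivative det (X 0) * mtrace (M * D)) (at 0)"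
    by simp
  from bounded_linear.has_vector_derivative[OF bounded_linear_Re this]
  have "((\<lambda>t. Re (det (X t))) has_real_derivative Re (det (X 0) * mtrace (M * D))) (at 0)"
    by (simp add: has_real_derivative_iff_has_vector_derivative)
  \<comment> \<open>\<open>det (X 0)\<close> is real, so \<open>Re\<close> splits the product; the
    derivative of \<open>ln\<close> then divides this factor out again.\<close>
  moreover have "Re (det (X 0) * mtrace (M * D)) = Re (det (X 0)) * Re (mtrace (M * D))"
    by (subst posdef_det(1)[OF X0]) simp
  ultimately have "((\<lambda>t. Re (det (X t))) has_real_derivative
      Re (det (X 0)) * Re (mtrace (M * D))) (at 0)"
    by (simp only:)
  from DERIV_chain2[where g = "\<lambda>t. Re (det (X t))", OF DERIV_ln_divide[OF posdef_det(2)[OF X0]] this]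
  show ?thesis
    using posdef_det(2)[OF X0] unfolding M_def by simp
qed

text \<open>Each entry is a quadratic polynomial in the real variable \<open>t\<close>; the term
  \<open>E * E\<^sup>H\<close> comes with the square of \<open>t\<close> and drops out at 0.\<close>

lemma has_vector_derivative_mult_herm:
  assumes Z: "Z \<in> carrier_mat m n" and E: "E \<in> carrier_mat m n" and ij: "i < m" "j < m"
  shows "((\<lambda>t. ((Z + complex_of_real t \<cdot>\<^sub>m E) * (Z + complex_of_real t \<cdot>\<^sub>m E)\<^sup>H) $$ (i, j))
    has_vector_derivative (E * Z\<^sup>H + Z * E\<^sup>H) $$ (i, j)) (at 0)"
proof -
  have "((\<lambda>t. \<Sum>k<n. (Z $$ (i, k) + complex_of_real t * E $$ (i, k)) *
        (cnj (Z $$ (j, k)) + complex_of_real t * cnj (E $$ (j, k)))) has_vector_derivative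
      (\<Sum>k<n. E $$ (i, k) * cnj (Z $$ (j, k)) + Z $$ (i, k) * cnj (E $$ (j, k)))) (at 0)"
    by (auto intro!: derivative_eq_intros sum.cong simp: algebra_simps)
  moreover have "((Z + complex_of_real t \<cdot>\<^sub>m E) * (Z + complex_of_real t \<cdot>\<^sub>m E)\<^sup>H) $$ (i, j) =
    (\<Sum>k<n. (Z $$ (i, k) + complex_of_real t * E $$ (i, k)) *
        (cnj (Z $$ (j, k)) + complex_of_real t * cnj (E $$ (j, k))))" for t
    using assms by (subst index_mult_sum) auto
  moreover have "(E * Z\<^sup>H + Z * E\<^sup>H) $$ (i, j) =
    (\<Sum>k<n. E $$ (i, k) * cnj (Z $$ (j, k)) + Z $$ (i, k) * cnj (E $$ (j, k)))"
    using assms by (simp add: index_mult_sum sum.distrib del: index_mult_mat(1))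
  ultimately show ?thesis by simp
qed

text \<open>As \<open>X\<close> is Hermitian, the two terms have complex conjugate traces. This
  doubling is the factor 2 of the gradient.\<close>

lemma Re_mtrace_mult_herm_variation:
  assumes X: "X \<in> carrier_mat m m" "X\<^sup>H = X"
    and Z: "Z \<in> carrier_mat m n" and E: "E \<in> carrier_mat m n"
  shows "Re (mtrace (X * (E * Z\<^sup>H + Z * E\<^sup>H))) = 2 * Re (mtrace ((X * Z)\<^sup>H * E))"
proof -
  have EZ: "E * Z\<^sup>H \<in> carrier_mat m m" "Z * E\<^sup>H \<in> carrier_mat m m"
    using Z E by auto
  have XZ: "(X * Z)\<^sup>H = Z\<^sup>H * X"
    using herm_mult[OF X(1) Z] X(2) by simp
  have 1: "mtrace (X * (E * Z\<^sup>H)) = mtrace ((X * Z)\<^sup>H * E)"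
  proof -
    have "mtrace (X * (E * Z\<^sup>H)) = mtrace ((X * E) * Z\<^sup>H)"
      by (simp add: assoc_mult_mat[OF X(1) E herm_carrier[OF Z]])
    also have "\<dots> = mtrace (Z\<^sup>H * (X * E))"
      by (rule mtrace_comm) (use X Z E in auto)
    also have "\<dots> = mtrace ((X * Z)\<^sup>H * E)"
      by (simp add: XZ assoc_mult_mat[OF herm_carrier[OF Z] X(1) E])
    finally show ?thesis .
  qed
  have "mtrace (X * (Z * E\<^sup>H)) = mtrace ((X * Z) * E\<^sup>H)"
    by (simp add: assoc_mult_mat[OF X(1) Z herm_carrier[OF E]])
  also have "\<dots> = mtrace ((E * (X * Z)\<^sup>H)\<^sup>H)"
    using herm_mult[OF E, of "(X * Z)\<^sup>H" m] X Z by auto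
  also have "\<dots> = cnj (mtrace (E * (X * Z)\<^sup>H))"
    by (rule mtrace_herm[of _ m]) (use X Z E in auto)
  also have "mtrace (E * (X * Z)\<^sup>H) = mtrace ((X * Z)\<^sup>H * E)"
    by (rule mtrace_comm) (use X Z E in auto)
  finally have 2: "mtrace (X * (Z * E\<^sup>H)) = cnj (mtrace ((X * Z)\<^sup>H * E))" .
  have "mtrace (X * (E * Z\<^sup>H + Z * E\<^sup>H)) = mtrace (X * (E * Z\<^sup>H)) + mtrace (X * (Z * E\<^sup>H))"
    using mult_add_distrib_mat[OF X(1) EZ] X EZ by (simp add: mtrace_add[of _ m])
  then show ?thesis using 1 2 by simp
qed

section \<open>The real inner product of matrices\<close>

abbreviation ip :: "complex mat \<Rightarrow> complex mat \<Rightarrow> real"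
  where "ip A B \<equiv> Re (mtrace (A\<^sup>H * B))"

lemma ip_sum:
  assumes "A \<in> carrier_mat m n" "B \<in> carrier_mat m n"
  shows "ip A B = (\<Sum>i<n. \<Sum>k<m. Re (cnj (A $$ (k, i)) * B $$ (k, i)))"
  using assms by (simp add: mtrace_mult[OF herm_carrier[OF assms(1)] assms(2)] del: times_complex.simps)

lemma ip_diff:
  assumes "A \<in> carrier_mat m n" "A' \<in> carrier_mat m n" "B \<in> carrier_mat m n"
  shows "ip (A - A') B = ip A B - ip A' B"
  using assms by (simp add: ip_sum[of _ m n] minus_carrier_mat sum_subtractf algebra_simps)

lemma ip_smult:
  assumes "A \<in> carrier_mat m n" "B \<in> carrier_mat m n"
  shows "ip (complex_of_real c \<cdot>\<^sub>m A) B = c * ip A B"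
  using assms by (simp add: ip_sum[of _ m n] sum_distrib_left algebra_simps)

lemma ip_commute:
  assumes "A \<in> carrier_mat m n" "B \<in> carrier_mat m n"
  shows "ip A B = ip B A"
  using assms by (simp add: ip_sum[of _ m n] mult.commute)

lemma frob_diff_sq:
  assumes A: "A \<in> carrier_mat m n" and B: "B \<in> carrier_mat m n"
  shows "(frob (A - B))\<^sup>2 = (frob A)\<^sup>2 - 2 * ip A B + (frob B)\<^sup>2"
proof -
  have C: "A - B \<in> carrier_mat m n" using B by auto
  have "(frob (A - B))\<^sup>2 = ip A (A - B) - ip B (A - B)"
    using mtrace_herm_mult_self[OF C] ip_diff[OF A B C] by simp
  also have "\<dots> = (ip A A - ip B A) - (ip A B - ip B B)"
    by (simp only: ip_commute[OF _ C] A B ip_diff[OF A B])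
  also have "\<dots> = (frob A)\<^sup>2 - 2 * ip A B + (frob B)\<^sup>2"
    by (simp add: mtrace_herm_mult_self[OF A] mtrace_herm_mult_self[OF B] ip_commute[OF B A])
  finally show ?thesis .
qed

lemma frob_diff_eq_0D:
  assumes "A \<in> carrier_mat m n" "B \<in> carrier_mat m n" "frob (A - B) = 0"
  shows "A = B"
proof (rule eq_matI)
  have "A - B = 0\<^sub>m m n"
    by (rule frob_eq_0D[OF minus_carrier_mat[OF assms(2)] assms(3)])
  moreover have "A $$ (i, j) = B $$ (i, j) + (A - B) $$ (i, j)" if "i < dim_row B" "j < dim_col B" for i j
    using that by simp
  ultimately show "A $$ (i, j) = B $$ (i, j)" if "i < dim_row B" "j < dim_col B" for i j
    using that assms(2) by simp
qed (use assms in auto)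

section \<open>Finite sums of matrices\<close>

lemma msum_carrier [simp, intro]: "msum m n A J \<in> carrier_mat m n"
  by (simp add: msum_def)

lemma ip_msum:
  assumes A: "\<And>j. j \<in> J \<Longrightarrow> A j \<in> carrier_mat m n" and B: "B \<in> carrier_mat m n"
  shows "ip (msum m n A J) B = (\<Sum>j\<in>J. ip (A j) B)"
proof -
  have "ip (msum m n A J) B = (\<Sum>i<n. \<Sum>k<m. \<Sum>j\<in>J. Re (cnj (A j $$ (k, i)) * B $$ (k, i)))"
    using B by (simp add: ip_sum[of _ m n] msum_def sum_distrib_right sum.distrib sum_subtractf)
  also have "\<dots> = (\<Sum>i<n. \<Sum>j\<in>J. \<Sum>k<m. Re (cnj (A j $$ (k, i)) * B $$ (k, i)))"
    by (intro sum.cong refl sum.swap)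
  also have "\<dots> = (\<Sum>j\<in>J. \<Sum>i<n. \<Sum>k<m. Re (cnj (A j $$ (k, i)) * B $$ (k, i)))"
    by (rule sum.swap)
  finally show ?thesis
    using ip_sum[OF A B] by simp
qed

lemma msum_mult:
  assumes A: "\<And>j. j \<in> J \<Longrightarrow> A j \<in> carrier_mat m n" and B: "B \<in> carrier_mat n p"
  shows "msum m n A J * B = msum m p (\<lambda>j. A j * B) J"
proof (rule eq_matI)
  fix i k assume "i < dim_row (msum m p (\<lambda>j. A j * B) J)" "k < dim_col (msum m p (\<lambda>j. A j * B) J)"
  then have ik: "i < m" "k < p" by (auto simp: msum_def)
  have "(msum m n A J * B) $$ (i, k) = (\<Sum>l<n. \<Sum>j\<in>J. A j $$ (i, l) * B $$ (l, k))"
    using ik B by (subst index_mult_sum) (auto simp: msum_def sum_distrib_right)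
  also have "\<dots> = (\<Sum>j\<in>J. \<Sum>l<n. A j $$ (i, l) * B $$ (l, k))"
    by (rule sum.swap)
  also have "\<dots> = (\<Sum>j\<in>J. (A j * B) $$ (i, k))"
    using ik B A by (intro sum.cong refl, subst index_mult_sum) auto
  finally show "(msum m n A J * B) $$ (i, k) = msum m p (\<lambda>j. A j * B) J $$ (i, k)"
    using ik by (simp add: msum_def)
qed (use B in \<open>auto simp: msum_def\<close>)

lemma msum_insert:
  assumes "finite J" "i \<notin> J" "A i \<in> carrier_mat m n"
  shows "msum m n A (insert i J) = msum m n A J + A i"
  by (rule eq_matI) (use assms in \<open>auto simp: msum_def\<close>)

lemma msum_cong: "(\<And>j. j \<in> J \<Longrightarrow> A j = B j) \<Longrightarrow> msum m n A J = msum m n B J"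
  by (simp add: msum_def)

section \<open>The gradient of the weighted sum rate\<close>

text \<open>In the direction \<open>G - G'\<close> both candidates give the same derivative, which
  makes the squared norm of \<open>G - G'\<close> zero. This justifies \<open>THE\<close> in
  \<open>block_gradient\<close>.\<close>

lemma has_block_gradient_unique:
  assumes G: "has_block_gradient f W k G" and G': "has_block_gradient f W k G'"
  shows "G = G'"
proof -
  have C: "G \<in> carrier_mat (dim_row (W k)) (dim_col (W k))"
    "G' \<in> carrier_mat (dim_row (W k)) (dim_col (W k))"
    using G G' by (auto simp: has_block_gradient_def)
  have D: "G - G' \<in> carrier_mat (dim_row (W k)) (dim_col (W k))" using C by auto
  have "ip G (G - G') = ip G' (G - G')"
    using G G' D unfolding has_block_gradient_def by (blast intro: DERIV_unique)
  then have "(frob (G - G'))\<^sup>2 = 0"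
    using ip_diff[OF C D] mtrace_herm_mult_self[OF D] by simp
  then show ?thesis using frob_diff_eq_0D[OF C] by simp
qed

lemma block_gradient_eq: "has_block_gradient f W k G \<Longrightarrow> block_gradient f W k = G"
  unfolding block_gradient_def by (blast intro: has_block_gradient_unique)

section \<open>Covariances at the receivers and the rates they determine\<close>

locale mimo =
  fixes K :: nat
    and Mr Mt Ms :: "nat \<Rightarrow> nat"
    and H :: "nat \<Rightarrow> nat \<Rightarrow> complex mat"
    and \<sigma> :: "nat \<Rightarrow> real"
  assumes channel: "\<And>i j. i \<in> {1..K} \<Longrightarrow> j \<in> {1..K} \<Longrightarrow> H i j \<in> carrier_mat (Mr i) (Mt j)"
    and noise: "\<And>k. k \<in> {1..K} \<Longrightarrow> 0 < (\<sigma> k)\<^sup>2"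
begin

declare One_nat_def [simp del] \<comment> \<open>keeps the simplifier from rewriting \<open>{1..K}\<close>\<close>

text \<open>Sizes only, no power bound: the perturbed families along which the rate is
  differentiated may leave the feasible set.\<close>

definition beamformers :: "(nat \<Rightarrow> complex mat) \<Rightarrow> bool"
  where "beamformers W \<longleftrightarrow> (\<forall>k\<in>{1..K}. W k \<in> carrier_mat (Mt k) (Ms k))"

text \<open>Covariance at receiver \<open>j\<close> of the noise and the signals of the links in \<open>J\<close>.\<close>

definition cov :: "(nat \<Rightarrow> complex mat) \<Rightarrow> nat set \<Rightarrow> nat \<Rightarrow> complex mat"
  where "cov W J j = msum (Mr j) (Mr j) (\<lambda>i. H j i * W i * (W i)\<^sup>H * (H j i)\<^sup>H) J
    + complex_of_real ((\<sigma> j)\<^sup>2) \<cdot>\<^sub>m 1\<^sub>m (Mr j)"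

lemma F_mat_eq_cov: "F_mat K Mr H \<sigma> W j = cov W ({1..K} - {j}) j"
  by (simp add: F_mat_def cov_def)

lemma signal_carrier:
  assumes "beamformers W" "i \<in> {1..K}" "j \<in> {1..K}"
  shows "H j i * W i \<in> carrier_mat (Mr j) (Ms i)"
  using assms channel[of j i] by (auto simp: beamformers_def)

lemma signal_covariance:
  assumes W: "beamformers W" and i: "i \<in> {1..K}" and j: "j \<in> {1..K}"
  shows "H j i * W i * (W i)\<^sup>H * (H j i)\<^sup>H = (H j i * W i) * (H j i * W i)\<^sup>H"
proof -
  have C: "W i \<in> carrier_mat (Mt i) (Ms i)" "H j i \<in> carrier_mat (Mr j) (Mt i)"
    using W channel i j by (auto simp: beamformers_def)
  show ?thesis
    by (simp add: herm_mult[OF C(2,1)]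
      assoc_mult_mat[OF mult_carrier_mat[OF C(2,1)] herm_carrier[OF C(1)] herm_carrier[OF C(2)]])
qed

text \<open>Splitting off a single link serves both as the induction step for positive definiteness
  and to isolate the dependence on one block.\<close>

lemma cov_insert:
  assumes W: "beamformers W" and i: "i \<in> {1..K}" and j: "j \<in> {1..K}" and J: "finite J" "i \<notin> J"
  shows "cov W (insert i J) j = cov W J j + (H j i * W i) * (H j i * W i)\<^sup>H"
proof -
  define Z where "Z = (H j i * W i) * (H j i * W i)\<^sup>H"
  define M where "M = msum (Mr j) (Mr j) (\<lambda>i. H j i * W i * (W i)\<^sup>H * (H j i)\<^sup>H) J"
  have Z: "Z \<in> carrier_mat (Mr j) (Mr j)"
    unfolding Z_def using signal_carrier[OF W i j] by auto
  have M: "M \<in> carrier_mat (Mr j) (Mr j)" by (auto simp: M_def)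
  have "cov W (insert i J) j = M + Z + complex_of_real ((\<sigma> j)\<^sup>2) \<cdot>\<^sub>m 1\<^sub>m (Mr j)"
    using J Z by (simp add: cov_def msum_insert signal_covariance[OF W i j] Z_def M_def)
  also have "\<dots> = cov W J j + Z"
    by (rule eq_matI) (use M Z in \<open>auto simp: cov_def M_def\<close>)
  finally show ?thesis by (simp add: Z_def)
qed

text \<open>Induction on \<open>J\<close>: the noise is positive definite, and every link adds a
  positive semidefinite term.\<close>

lemma posdef_cov:
  assumes W: "beamformers W" and j: "j \<in> {1..K}" and "J \<subseteq> {1..K}"
  shows "posdef (Mr j) (cov W J j)"
proof -
  have "finite J" using assms(3) finite_subset by blast
  then show ?thesis using assms(3)
  proof (induction J rule: finite_induct)
    case empty
    have "cov W {} j = complex_of_real ((\<sigma> j)\<^sup>2) \<cdot>\<^sub>m 1\<^sub>m (Mr j)"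
      by (rule eq_matI) (auto simp: cov_def msum_def)
    then show ?case using posdef_smult_one[OF noise[OF j]] by simp
  next
    case (insert i J)
    then show ?case
      by (simp add: cov_insert[OF W _ j] posdef_add_mult_herm[OF _ signal_carrier[OF W _ j]])
  qed
qed

lemma cov_carrier:
  "beamformers W \<Longrightarrow> j \<in> {1..K} \<Longrightarrow> J \<subseteq> {1..K} \<Longrightarrow> cov W J j \<in> carrier_mat (Mr j) (Mr j)"
  using posdef_cov by (simp add: posdef_def)

text \<open>Along a variation of block \<open>k\<close> this keeps fixed the part of a covariance
  without link \<open>k\<close>, and all of the interference at receiver \<open>k\<close>.\<close>

lemma cov_update_other: "k \<notin> J \<Longrightarrow> cov (W(k := X)) J j = cov W J j"
  by (auto simp: cov_def intro!: arg_cong[where f = "\<lambda>M. M + _"] msum_cong)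

lemma beamformers_update:
  "beamformers W \<Longrightarrow> X \<in> carrier_mat (Mt k) (Ms k) \<Longrightarrow> beamformers (W(k := X))"
  by (auto simp: beamformers_def)

lemma cov_full:
  assumes "beamformers W" "j \<in> {1..K}"
  shows "cov W {1..K} j = cov W ({1..K} - {j}) j + (H j j * W j) * (H j j * W j)\<^sup>H"
  using cov_insert[OF assms(1,2,2), of "{1..K} - {j}"] assms(2) by (simp add: insert_absorb)

text \<open>The curve is a constant plus \<open>(Z + t E) * (Z + t E)\<^sup>H\<close> with the
  received signal \<open>Z = H j k * W k\<close>. Jacobi's formula gives the gradient with respect
  to \<open>Z\<close>, and the chain rule multiplies it by the adjoint of
  \<open>H j k\<close>.\<close>

lemma has_real_derivative_ln_det_cov:
  assumes W: "beamformers W" and j: "j \<in> {1..K}" and J: "J \<subseteq> {1..K}" and k: "k \<in> J"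
    and \<Delta>: "\<Delta> \<in> carrier_mat (Mt k) (Ms k)"
  shows "((\<lambda>t. ln (Re (det (cov (W(k := W k + complex_of_real t \<cdot>\<^sub>m \<Delta>)) J j)))) has_real_derivative
    2 * ip ((H j k)\<^sup>H * minv (cov W J j) * H j k * W k) \<Delta>) (at 0)"
proof -
  have kK: "k \<in> {1..K}" using J k by auto
  have Hjk: "H j k \<in> carrier_mat (Mr j) (Mt k)" using channel j kK by auto
  have Wk: "W k \<in> carrier_mat (Mt k) (Ms k)" using W kK by (auto simp: beamformers_def)
  define V where "V t = W(k := W k + complex_of_real t \<cdot>\<^sub>m \<Delta>)" for t
  define Z where "Z = H j k * W k"
  define E where "E = H j k * \<Delta>"
  have Z: "Z \<in> carrier_mat (Mr j) (Ms k)" and E: "E \<in> carrier_mat (Mr j) (Ms k)"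
    using Hjk Wk \<Delta> by (auto simp: Z_def E_def)
  define D where "D = E * Z\<^sup>H + Z * E\<^sup>H"
  have D: "D \<in> carrier_mat (Mr j) (Mr j)" using Z E by (auto simp: D_def)
  have V: "beamformers (V t)" for t
    unfolding V_def by (rule beamformers_update) (use W Wk \<Delta> in auto)
  have HV: "H j k * V t k = Z + complex_of_real t \<cdot>\<^sub>m E" for t
    unfolding V_def Z_def E_def using Hjk Wk \<Delta>
    by (simp add: mult_add_distrib_mat[of _ "Mr j" "Mt k" _ "Ms k"] mult_smult_distrib[of _ "Mr j" "Mt k" _ "Ms k"])
  have cov: "cov (V t) J j =
      cov W (J - {k}) j + (Z + complex_of_real t \<cdot>\<^sub>m E) * (Z + complex_of_real t \<cdot>\<^sub>m E)\<^sup>H" for t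
    using cov_insert[OF V kK j, of "J - {k}" t] k finite_subset[OF J]
    by (simp add: insert_absorb HV) (simp add: V_def cov_update_other)
  have V0: "cov (V 0) J j = cov W J j"
  proof -
    have "V 0 = W" by (auto simp: V_def fun_eq_iff intro!: eq_matI) (use Wk \<Delta> in auto)
    then show ?thesis by simp
  qed
  note pd = posdef_cov[OF W j J]
  note inv = posdef_minv[OF pd]
  have "((\<lambda>t. ln (Re (det (cov (V t) J j)))) has_real_derivative
      Re (mtrace (minv (cov (V 0) J j) * D))) (at 0)"
  proof (rule has_real_derivative_ln_det)
    fix a b assume ab: "a < Mr j" "b < Mr j"
    have "((\<lambda>t. cov W (J - {k}) j $$ (a, b) +
        ((Z + complex_of_real t \<cdot>\<^sub>m E) * (Z + complex_of_real t \<cdot>\<^sub>m E)\<^sup>H) $$ (a, b))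
        has_vector_derivative 0 + D $$ (a, b)) (at 0)"
      unfolding D_def
      by (intro has_vector_derivative_add has_vector_derivative_const has_vector_derivative_mult_herm[OF Z E ab])
    moreover have "cov (V t) J j $$ (a, b) = cov W (J - {k}) j $$ (a, b) +
        ((Z + complex_of_real t \<cdot>\<^sub>m E) * (Z + complex_of_real t \<cdot>\<^sub>m E)\<^sup>H) $$ (a, b)" for t
      unfolding cov using ab Z E by (simp del: index_mult_mat(1))
    ultimately show "((\<lambda>t. cov (V t) J j $$ (a, b)) has_vector_derivative D $$ (a, b)) (at 0)"
      by simp
  qed (use cov_carrier[OF V j J] posdef_cov[OF V j J] D in auto)
  moreover have "Re (mtrace (minv (cov (V 0) J j) * D)) = 2 * ip (minv (cov W J j) * Z) E"
    unfolding V0 D_def by (rule Re_mtrace_mult_herm_variation[OF inv(1,4) Z E])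
  moreover have "ip (minv (cov W J j) * Z) E = ip ((H j k)\<^sup>H * minv (cov W J j) * H j k * W k) \<Delta>"
  proof -
    define Y where "Y = minv (cov W J j) * Z"
    have Y: "Y \<in> carrier_mat (Mr j) (Ms k)" using inv(1) Z by (auto simp: Y_def)
    have "(H j k)\<^sup>H * minv (cov W J j) * H j k * W k = (H j k)\<^sup>H * Y"
      unfolding Y_def Z_def
        assoc_mult_mat[OF mult_carrier_mat[OF herm_carrier[OF Hjk] inv(1)] Hjk Wk]
      by (rule assoc_mult_mat[OF herm_carrier[OF Hjk] inv(1) mult_carrier_mat[OF Hjk Wk]])
    then have "((H j k)\<^sup>H * minv (cov W J j) * H j k * W k)\<^sup>H * \<Delta> = Y\<^sup>H * H j k * \<Delta>"
      using herm_mult[OF herm_carrier[OF Hjk] Y] by simp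
    also have "\<dots> = Y\<^sup>H * E"
      unfolding E_def by (rule assoc_mult_mat[OF herm_carrier[OF Y] Hjk \<Delta>])
    finally show ?thesis by (simp add: Y_def)
  qed
  ultimately show ?thesis by (simp add: V_def)
qed

text \<open>With \<open>Z = H j j * W j\<close>, Sylvester's identity moves the determinant to the
  receive side as that of \<open>1 + minv F * Z * Z\<^sup>H\<close>; multiplying by \<open>F\<close>
  on the left yields the full covariance.\<close>

lemma det_rate:
  assumes W: "beamformers W" and j: "j \<in> {1..K}"
  shows "Re (det (1\<^sub>m (Ms j) + (W j)\<^sup>H * (H j j)\<^sup>H * minv (F_mat K Mr H \<sigma> W j) * H j j * W j))
    = Re (det (cov W {1..K} j)) / Re (det (cov W ({1..K} - {j}) j))"
proof -
  define F where "F = cov W ({1..K} - {j}) j"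
  define Z where "Z = H j j * W j"
  have pF: "posdef (Mr j) F" and pT: "posdef (Mr j) (cov W {1..K} j)"
    unfolding F_def by (intro posdef_cov[OF W j]; simp)+
  have F: "F \<in> carrier_mat (Mr j) (Mr j)" using pF by (simp add: posdef_def)
  note inv = posdef_minv[OF pF]
  have C: "H j j \<in> carrier_mat (Mr j) (Mt j)" "W j \<in> carrier_mat (Mt j) (Ms j)"
    using W j channel by (auto simp: beamformers_def)
  have Z: "Z \<in> carrier_mat (Mr j) (Ms j)" using C by (auto simp: Z_def)
  have "(W j)\<^sup>H * (H j j)\<^sup>H * minv F * H j j * W j = Z\<^sup>H * minv F * H j j * W j"
    by (simp add: Z_def herm_mult[OF C])
  also have "\<dots> = Z\<^sup>H * (minv F * Z)"
    unfolding Z_def[symmetric]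
      assoc_mult_mat[OF mult_carrier_mat[OF herm_carrier[OF Z] inv(1)] C]
    by (rule assoc_mult_mat[OF herm_carrier[OF Z] inv(1) Z])
  finally have 1: "det (1\<^sub>m (Ms j) + (W j)\<^sup>H * (H j j)\<^sup>H * minv F * H j j * W j)
      = det (1\<^sub>m (Mr j) + minv F * Z * Z\<^sup>H)"
    using det_one_add_mult_comm[OF herm_carrier[OF Z] mult_carrier_mat[OF inv(1) Z]] by simp
  have "F * (1\<^sub>m (Mr j) + minv F * Z * Z\<^sup>H) = F + F * (minv F * (Z * Z\<^sup>H))"
    using F inv Z by (simp add: mult_add_distrib_mat[of _ "Mr j" "Mr j" _ "Mr j"]
        assoc_mult_mat[OF inv(1) Z herm_carrier[OF Z]])
  also have "F * (minv F * (Z * Z\<^sup>H)) = Z * Z\<^sup>H"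
    using F inv(1,2) Z by (simp add: assoc_mult_mat[of F "Mr j" "Mr j" "minv F" "Mr j" "Z * Z\<^sup>H" "Mr j", symmetric])
  also have "F + Z * Z\<^sup>H = cov W {1..K} j"
    by (simp add: cov_full[OF W j] F_def Z_def)
  finally have "det F * det (1\<^sub>m (Mr j) + minv F * Z * Z\<^sup>H) = det (cov W {1..K} j)"
    using det_mult[OF F add_carrier_mat[OF
          mult_carrier_mat[OF mult_carrier_mat[OF inv(1) Z] herm_carrier[OF Z]]], of "1\<^sub>m (Mr j)"]
    by simp
  \<comment> \<open>Both covariance determinants are positive reals, so the complex quotient is the
    real one.\<close>
  then have "det (1\<^sub>m (Mr j) + minv F * Z * Z\<^sup>H) =
      complex_of_real (Re (det (cov W {1..K} j)) / Re (det F))"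
    using posdef_det[OF pF] posdef_det[OF pT]
    by (metis mult.commute nonzero_eq_divide_eq of_real_divide of_real_0 of_real_eq_iff less_irrefl)
  then show ?thesis
    using 1 by (simp add: F_mat_eq_cov F_def)
qed

lemma wsr_eq_sum_ln_det:
  assumes W: "beamformers W"
  shows "wsr K Mr Ms H \<sigma> \<omega> W =
    (\<Sum>j=1..K. \<omega> j * (ln (Re (det (cov W {1..K} j))) - ln (Re (det (cov W ({1..K} - {j}) j)))))"
  unfolding wsr_def
proof (intro sum.cong refl, goal_cases)
  case (1 j)
  have "0 < Re (det (cov W {1..K} j))" "0 < Re (det (cov W ({1..K} - {j}) j))"
    by (rule posdef_det(2)[OF posdef_cov[OF W 1]]; simp)+
  then show ?case
    by (simp add: det_rate[OF W 1] ln_div)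
qed

text \<open>With \<open>T\<close> and \<open>F\<close> the covariances with and without the own
  signal, \<open>A_mat\<close> is \<open>minv T * (Z * Z\<^sup>H) * minv F\<close>. As
  \<open>Z * Z\<^sup>H = T - F\<close>, expanding the product leaves the difference of the
  inverses.\<close>

lemma A_mat_eq:
  assumes W: "beamformers W" and j: "j \<in> {1..K}"
  shows "A_mat K Mr H \<sigma> W j = minv (cov W ({1..K} - {j}) j) - minv (cov W {1..K} j)"
proof -
  define F where "F = cov W ({1..K} - {j}) j"
  define T where "T = cov W {1..K} j"
  define Z where "Z = H j j * W j"
  have pF: "posdef (Mr j) F" and pT: "posdef (Mr j) T"
    unfolding F_def T_def by (intro posdef_cov[OF W j]; simp)+
  have F: "F \<in> carrier_mat (Mr j) (Mr j)" and T: "T \<in> carrier_mat (Mr j) (Mr j)"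
    using pF pT by (auto simp: posdef_def)
  note iF = posdef_minv[OF pF] and iT = posdef_minv[OF pT]
  have C: "H j j \<in> carrier_mat (Mr j) (Mt j)" "W j \<in> carrier_mat (Mt j) (Ms j)"
    using W j channel by (auto simp: beamformers_def)
  have Z: "Z \<in> carrier_mat (Mr j) (Ms j)" using C by (auto simp: Z_def)
  have TF: "T = F + Z * Z\<^sup>H"
    by (simp add: cov_full[OF W j] F_def Z_def T_def)
  have ZZ: "Z * Z\<^sup>H = T - F"
    unfolding TF by (rule eq_matI) (use F Z in auto)
  have "A_mat K Mr H \<sigma> W j = minv T * H j j * W j * (Z\<^sup>H * minv F)"
    unfolding A_mat_def B_mat_def F_mat_eq_cov F_def[symmetric] signal_covariance[OF W j j]
    by (simp add: Z_def[symmetric] TF[symmetric] herm_mult[OF C, folded Z_def, symmetric])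
  also have "\<dots> = minv T * (T - F) * minv F"
    using C iT(1) iF(1) Z unfolding Z_def ZZ[unfolded Z_def, symmetric]
    by (simp add: assoc_mult_mat[OF iT(1) C]
        assoc_mult_mat[of _ "Mr j" "Ms j" _ "Mr j" _ "Mr j", symmetric]
        assoc_mult_mat[OF iT(1) Z herm_carrier[OF Z], unfolded Z_def])
  also have "\<dots> = (1\<^sub>m (Mr j) - minv T * F) * minv F"
    by (simp add: mult_minus_distrib_mat[OF iT(1) T F] iT(3))
  also have "\<dots> = minv F - minv T * F * minv F"
    using minus_mult_distrib_mat[OF one_carrier_mat mult_carrier_mat[OF iT(1) F] iF(1)] iF(1) by simp
  also have "minv T * F * minv F = minv T"
    using iT(1) by (simp add: assoc_mult_mat[OF iT(1) F iF(1)] iF(2))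
  finally show ?thesis by (simp add: F_def T_def)
qed

text \<open>Up to the weights, link \<open>j\<close> contributes
  \<open>N j (T j) - N j (F j)\<close> to half the gradient, and summed over all links this is minus
  \<open>S_mat\<close> times \<open>W k\<close>. For \<open>j = k\<close> the second term must be
  absent, since the interference at receiver \<open>k\<close> does not depend on block
  \<open>k\<close>; the term with \<open>B_mat\<close> cancels it.\<close>

lemma has_block_gradient_wsr:
  assumes W: "beamformers W" and k: "k \<in> {1..K}"
  shows "has_block_gradient (wsr K Mr Ms H \<sigma> \<omega>) W k
    (2 \<cdot>\<^sub>m (complex_of_real (\<omega> k) \<cdot>\<^sub>m ((H k k)\<^sup>H * (B_mat K Mr H \<sigma> W k)\<^sup>H)
      - S_mat K Mr Mt H \<sigma> \<omega> W k * W k))"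
    (is "has_block_gradient ?f W k ?G")
proof -
  \<comment> \<open>For \<open>X\<close> the inverse of a covariance at receiver \<open>j\<close>
    that includes link \<open>k\<close>, this is half the gradient of the log-determinant of that
    covariance.\<close>
  define N where "N j X = (H j k)\<^sup>H * X * H j k * W k" for j X
  \<comment> \<open>\<open>F\<close> and \<open>T\<close> denote inverses here, of the covariances
    without and with the own signal.\<close>
  define F where "F j = minv (cov W ({1..K} - {j}) j)" for j
  define T where "T j = minv (cov W {1..K} j)" for j
  have Wk: "W k \<in> carrier_mat (Mt k) (Ms k)" using W k by (auto simp: beamformers_def)
  have iF: "F j \<in> carrier_mat (Mr j) (Mr j)" "(F j)\<^sup>H = F j"
    and iT: "T j \<in> carrier_mat (Mr j) (Mr j)" if "j \<in> {1..K}" for j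
    unfolding F_def T_def by (rule posdef_minv[OF posdef_cov[OF W that]]; simp)+
  have N: "N j X \<in> carrier_mat (Mt k) (Ms k)"
    if "j \<in> {1..K}" "X \<in> carrier_mat (Mr j) (Mr j)" for j X
    using that channel[OF that(1) k] Wk by (auto simp: N_def)
  have N_diff: "(H j k)\<^sup>H * (X - Y) * H j k * W k = N j X - N j Y"
    if j: "j \<in> {1..K}" and X: "X \<in> carrier_mat (Mr j) (Mr j)" and Y: "Y \<in> carrier_mat (Mr j) (Mr j)" for j X Y
  proof -
    note Hj = channel[OF j k]
    note HX = mult_carrier_mat[OF herm_carrier[OF Hj] X] and HY = mult_carrier_mat[OF herm_carrier[OF Hj] Y]
    show ?thesis
      by (simp add: N_def mult_minus_distrib_mat[OF herm_carrier[OF Hj] X Y]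
          minus_mult_distrib_mat[OF HX HY Hj]
          minus_mult_distrib_mat[OF mult_carrier_mat[OF HX Hj] mult_carrier_mat[OF HY Hj] Wk])
  qed
  have SW: "S_mat K Mr Mt H \<sigma> \<omega> W k * W k =
      msum (Mt k) (Ms k) (\<lambda>j. complex_of_real (\<omega> j) \<cdot>\<^sub>m (N j (F j) - N j (T j))) {1..K}"
  proof -
    have A: "A_mat K Mr H \<sigma> W j \<in> carrier_mat (Mr j) (Mr j)" if "j \<in> {1..K}" for j
      using iF[OF that] iT[OF that] by (auto simp: A_mat_eq[OF W that] F_def T_def)
    have HAH: "(H j k)\<^sup>H * A_mat K Mr H \<sigma> W j * H j k \<in> carrier_mat (Mt k) (Mt k)"
      if "j \<in> {1..K}" for j
      using A[OF that] channel[OF that k] by auto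
    have "S_mat K Mr Mt H \<sigma> \<omega> W k * W k = msum (Mt k) (Ms k)
        (\<lambda>j. (complex_of_real (\<omega> j) \<cdot>\<^sub>m ((H j k)\<^sup>H * A_mat K Mr H \<sigma> W j * H j k)) * W k) {1..K}"
      unfolding S_mat_def by (rule msum_mult[OF _ Wk]) (use HAH in auto)
    also have "\<dots> = msum (Mt k) (Ms k) (\<lambda>j. complex_of_real (\<omega> j) \<cdot>\<^sub>m (N j (F j) - N j (T j))) {1..K}"
    proof (rule msum_cong)
      fix j assume j: "j \<in> {1..K}"
      have "complex_of_real (\<omega> j) \<cdot>\<^sub>m ((H j k)\<^sup>H * A_mat K Mr H \<sigma> W j * H j k) * W k =
        complex_of_real (\<omega> j) \<cdot>\<^sub>m ((H j k)\<^sup>H * A_mat K Mr H \<sigma> W j * H j k * W k)"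
        by (rule mult_smult_assoc_mat[OF HAH[OF j] Wk])
      then show "complex_of_real (\<omega> j) \<cdot>\<^sub>m ((H j k)\<^sup>H * A_mat K Mr H \<sigma> W j * H j k) * W k =
        complex_of_real (\<omega> j) \<cdot>\<^sub>m (N j (F j) - N j (T j))"
        using N_diff[OF j iF(1)[OF j] iT[OF j]] by (simp add: A_mat_eq[OF W j] F_def T_def)
    qed
    finally show ?thesis .
  qed
  \<comment> \<open>\<open>B_mat\<close> is the adjoint of the received signal times
    \<open>F k\<close>; as \<open>F k\<close> is Hermitian, the adjoint of \<open>B_mat\<close> is
    \<open>F k * (H k k * W k)\<close>.\<close>
  have HB: "(H k k)\<^sup>H * (B_mat K Mr H \<sigma> W k)\<^sup>H = N k (F k)"
  proof -
    note Hk = channel[OF k k]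
    have "B_mat K Mr H \<sigma> W k = (H k k * W k)\<^sup>H * F k"
      by (simp add: B_mat_def F_mat_eq_cov F_def herm_mult[OF Hk Wk])
    then have "(B_mat K Mr H \<sigma> W k)\<^sup>H = F k * (H k k * W k)"
      using herm_mult[OF herm_carrier[OF mult_carrier_mat[OF Hk Wk]] iF(1)[OF k]] iF(2)[OF k] by simp
    then show ?thesis
      by (simp add: N_def assoc_mult_mat[OF mult_carrier_mat[OF herm_carrier[OF Hk] iF(1)[OF k]] Hk Wk]
          assoc_mult_mat[OF herm_carrier[OF Hk] iF(1)[OF k] mult_carrier_mat[OF Hk Wk]])
  qed
  have G: "?G \<in> carrier_mat (Mt k) (Ms k)"
    unfolding HB SW by (intro smult_carrier_mat minus_carrier_mat msum_carrier)
  have "((\<lambda>t. ?f (W(k := W k + complex_of_real t \<cdot>\<^sub>m \<Delta>))) has_real_derivative ip ?G \<Delta>) (at 0)"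
    if \<Delta>: "\<Delta> \<in> carrier_mat (Mt k) (Ms k)" for \<Delta>
  proof -
    define V where "V t = W(k := W k + complex_of_real t \<cdot>\<^sub>m \<Delta>)" for t
    have V: "beamformers (V t)" for t
      unfolding V_def by (rule beamformers_update) (use W Wk \<Delta> in auto)
    have dT: "((\<lambda>t. ln (Re (det (cov (V t) {1..K} j)))) has_real_derivative 2 * ip (N j (T j)) \<Delta>) (at 0)"
      if j: "j \<in> {1..K}" for j
      unfolding V_def N_def T_def
      by (rule has_real_derivative_ln_det_cov[OF W j _ k \<Delta>]) simp
    have dF: "((\<lambda>t. ln (Re (det (cov (V t) ({1..K} - {j}) j)))) has_real_derivative
        (if j = k then 0 else 2 * ip (N j (F j)) \<Delta>)) (at 0)"
      if j: "j \<in> {1..K}" for j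
    proof (cases "j = k")
      case True
      then show ?thesis by (simp add: V_def cov_update_other)
    next
      case False
      then show ?thesis
        unfolding V_def N_def F_def
        using has_real_derivative_ln_det_cov[OF W j _ _ \<Delta>, of "{1..K} - {j}"] k by simp
    qed
    have "((\<lambda>t. ?f (V t)) has_real_derivative
        (\<Sum>j=1..K. \<omega> j * (2 * ip (N j (T j)) \<Delta> - (if j = k then 0 else 2 * ip (N j (F j)) \<Delta>)))) (at 0)"
      unfolding wsr_eq_sum_ln_det[OF V]
      by (intro DERIV_sum DERIV_cmult DERIV_diff dT dF)
    moreover have "ip ?G \<Delta> =
        (\<Sum>j=1..K. \<omega> j * (2 * ip (N j (T j)) \<Delta> - (if j = k then 0 else 2 * ip (N j (F j)) \<Delta>)))"
    proof -
      have SWc: "msum (Mt k) (Ms k) (\<lambda>j. complex_of_real (\<omega> j) \<cdot>\<^sub>m (N j (F j) - N j (T j))) {1..K}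
          \<in> carrier_mat (Mt k) (Ms k)"
        by auto
      have "ip (msum (Mt k) (Ms k) (\<lambda>j. complex_of_real (\<omega> j) \<cdot>\<^sub>m (N j (F j) - N j (T j))) {1..K}) \<Delta> =
          (\<Sum>j=1..K. ip (complex_of_real (\<omega> j) \<cdot>\<^sub>m (N j (F j) - N j (T j))) \<Delta>)"
        by (rule ip_msum[OF _ \<Delta>]) (rule smult_carrier_mat minus_carrier_mat N iT | assumption)+
      also have "\<dots> = (\<Sum>j=1..K. \<omega> j * (ip (N j (F j)) \<Delta> - ip (N j (T j)) \<Delta>))"
      proof (rule sum.cong[OF refl])
        fix j assume j: "j \<in> {1..K}"
        note Nj = N[OF j iF(1)[OF j]] N[OF j iT[OF j]]
        show "ip (complex_of_real (\<omega> j) \<cdot>\<^sub>m (N j (F j) - N j (T j))) \<Delta> =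
          \<omega> j * (ip (N j (F j)) \<Delta> - ip (N j (T j)) \<Delta>)"
          by (simp add: ip_smult[OF minus_carrier_mat[OF Nj(2)] \<Delta>] ip_diff[OF Nj \<Delta>])
      qed
      finally have ipS: "ip (msum (Mt k) (Ms k) (\<lambda>j. complex_of_real (\<omega> j) \<cdot>\<^sub>m (N j (F j) - N j (T j))) {1..K}) \<Delta>
        = (\<Sum>j=1..K. \<omega> j * (ip (N j (F j)) \<Delta> - ip (N j (T j)) \<Delta>))" .
      have "ip ?G \<Delta> = 2 * (\<omega> k * ip (N k (F k)) \<Delta>
          - (\<Sum>j=1..K. \<omega> j * (ip (N j (F j)) \<Delta> - ip (N j (T j)) \<Delta>)))"
        unfolding HB SW ipS[symmetric]
        using ip_smult[OF minus_carrier_mat[OF SWc] \<Delta>, of 2]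
          ip_diff[OF smult_carrier_mat[OF N[OF k iF(1)[OF k]]] SWc \<Delta>]
          ip_smult[OF N[OF k iF(1)[OF k]] \<Delta>]
        by simp
      \<comment> \<open>Written as a sum over \<open>j\<close>, the single term merges with the
        other sum, and the summands can be compared one by one.\<close>
      also have "\<omega> k * ip (N k (F k)) \<Delta> = (\<Sum>j=1..K. if j = k then \<omega> j * ip (N j (F j)) \<Delta> else 0)"
        using k by simp
      also have "2 * (\<dots> - (\<Sum>j=1..K. \<omega> j * (ip (N j (F j)) \<Delta> - ip (N j (T j)) \<Delta>))) =
        (\<Sum>j=1..K. \<omega> j * (2 * ip (N j (T j)) \<Delta> - (if j = k then 0 else 2 * ip (N j (F j)) \<Delta>)))"
        unfolding sum_subtractf[symmetric] sum_distrib_left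
        by (intro sum.cong) (auto simp: algebra_simps)
      finally show ?thesis .
    qed
    ultimately show ?thesis by (simp only: V_def)
  qed
  then show ?thesis
    using G Wk unfolding has_block_gradient_def by auto
qed

end

section \<open>Projections onto power balls\<close>

text \<open>The obtuse angle criterion; unlike bare minimality, it survives weighted sums over blocks.\<close>

lemma power_ball_projection:
  assumes X: "X \<in> carrier_mat m n" and p: "0 < p"
  shows "\<exists>Y\<in>power_ball m n p. \<forall>Z\<in>power_ball m n p.
    (frob (Y - X))\<^sup>2 + (frob (Z - Y))\<^sup>2 \<le> (frob (Z - X))\<^sup>2"
proof (cases "(frob X)\<^sup>2 \<le> p")
  case True
  \<comment> \<open>A point of the ball is its own projection, and the inequality becomes an
    equality.\<close>
  have "X - X = 0\<^sub>m m n" using X by (intro eq_matI) auto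
  then have "frob (X - X) = 0" by (simp add: frob_def)
  with True show ?thesis
    using X by (intro bexI[of _ X]) (auto simp: power_ball_def)
next
  case False
  define s where "s = (frob X)\<^sup>2"
  \<comment> \<open>Chosen so that \<open>c\<close> times \<open>X\<close> lies on the sphere: its
    squared norm \<open>c\<^sup>2 * s\<close> is \<open>p\<close>.\<close>
  define c where "c = sqrt (p / s)"
  have s: "s > p" "s > 0" using False p by (auto simp: s_def)
  have c: "0 < c" "c < 1" "c\<^sup>2 * s = p"
    using s p by (auto simp: c_def)
  define Y where "Y = complex_of_real c \<cdot>\<^sub>m X"
  have Y: "Y \<in> carrier_mat m n" using X by (auto simp: Y_def)
  have ZY: "ip Z Y = c * ip Z X" if "Z \<in> carrier_mat m n" for Z
    using ip_commute[OF that Y] ip_commute[OF that X] ip_smult[OF X that] by (simp add: Y_def)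
  have YX: "ip Y X = c * s"
    unfolding Y_def ip_smult[OF X X] s_def by (simp add: mtrace_herm_mult_self[OF X])
  have YY: "(frob Y)\<^sup>2 = c\<^sup>2 * s"
    using mtrace_herm_mult_self[OF Y] ZY[OF Y] YX by (simp add: power2_eq_square)
  have "(frob (Y - X))\<^sup>2 + (frob (Z - Y))\<^sup>2 \<le> (frob (Z - X))\<^sup>2" if "Z \<in> power_ball m n p" for Z
  proof -
    have Z: "Z \<in> carrier_mat m n" "(frob Z)\<^sup>2 \<le> p" using that by (auto simp: power_ball_def)
    have ZmY: "(frob (Z - Y))\<^sup>2 = (frob Z)\<^sup>2 - 2 * (c * ip Z X) + c * (c * s)"
      unfolding frob_diff_sq[OF Z(1) Y] ZY[OF Z(1)] YY by (simp add: power2_eq_square)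
    \<comment> \<open>Cauchy-Schwarz in disguise: expanding the square and bounding
      \<open>(frob Z)\<^sup>2\<close> by \<open>p = c\<^sup>2 * s\<close> gives
      \<open>ip Z X \<le> c * s\<close>.\<close>
    have "0 \<le> (frob (Z - Y))\<^sup>2" by simp
    then have "0 \<le> 2 * (c * (c * s - ip Z X))"
      using Z(2) by (simp add: ZmY c(3)[symmetric] right_diff_distrib power2_eq_square[of c])
    then have "ip Z X \<le> c * s" using c by (simp add: zero_le_mult_iff)
    \<comment> \<open>This product is exactly the right side of the claim minus its left side, as
      the expansions below show.\<close>
    then have "0 \<le> 2 * ((1 - c) * (c * s - ip Z X))" using c by simp
    moreover have "(frob (Y - X))\<^sup>2 = c * (c * s) - 2 * (c * s) + s"
      unfolding frob_diff_sq[OF Y X] YX YY s_def[symmetric] by (simp add: power2_eq_square)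
    moreover have "(frob (Z - X))\<^sup>2 = (frob Z)\<^sup>2 - 2 * ip Z X + s"
      by (simp add: frob_diff_sq[OF Z(1) X] s_def)
    ultimately show ?thesis
      unfolding ZmY by (simp add: algebra_simps)
  qed
  then show ?thesis
    using Y YY c(3) by (intro bexI[of _ Y]) (auto simp: power_ball_def)
qed

text \<open>A strict gap at every other point yields existence and uniqueness together, in the form
  that \<open>arg_min_eqI\<close> needs.\<close>

lemma is_arg_min_iff_of_gap:
  fixes g :: "'a \<Rightarrow> real"
  assumes "P Y" and "\<And>Z. P Z \<Longrightarrow> Z \<noteq> Y \<Longrightarrow> g Y < g Z"
  shows "is_arg_min g P V \<longleftrightarrow> V = Y"
  using assms unfolding is_arg_min_def by (metis less_asym)

text \<open>\<open>arg_min\<close> picks some minimizer by choice, so uniqueness is what pins down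
  its value.\<close>

lemma arg_min_eqI:
  assumes "\<And>V. is_arg_min g P V \<longleftrightarrow> V = Y"
  shows "arg_min g P = Y"
  unfolding arg_min_def assms by simp

text \<open>The term \<open>(frob (Z - Y))\<^sup>2\<close> of the gap is positive away from
  \<open>Y\<close>, hence a strict comparison of squares and then of norms.\<close>

lemma proj_mat_eq:
  assumes X: "X \<in> carrier_mat m n" and Y: "Y \<in> power_ball m n p"
    and gap: "\<And>Z. Z \<in> power_ball m n p \<Longrightarrow> (frob (Y - X))\<^sup>2 + (frob (Z - Y))\<^sup>2 \<le> (frob (Z - X))\<^sup>2"
  shows "proj_mat (power_ball m n p) X = Y"
  unfolding proj_mat_def
proof (rule arg_min_eqI, rule is_arg_min_iff_of_gap)
  fix Z assume Z: "Z \<in> power_ball m n p" "Z \<noteq> Y"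
  then have "frob (Z - Y) \<noteq> 0"
    using frob_diff_eq_0D[of Z m n Y] Y by (auto simp: power_ball_def)
  then have "0 < (frob (Z - Y))\<^sup>2" by simp
  then have "(frob (Y - X))\<^sup>2 < (frob (Z - X))\<^sup>2"
    using gap[OF Z(1)] by linarith
  then show "frob (Y - X) < frob (Z - X)"
    by (rule power_less_imp_less_base) simp
qed (rule Y)

text \<open>Positive weights preserve each blockwise inequality, and distinct families make it
  strict in some block. So the minimizer is the same for all positive weights.\<close>

lemma feasible_weighted_gap:
  assumes \<eta>: "\<And>k. k \<in> {1..K} \<Longrightarrow> 0 < \<eta> k"
    and Y: "Y \<in> feasible K Mt Ms P"
    and gap: "\<And>k Z. k \<in> {1..K} \<Longrightarrow> Z \<in> power_ball (Mt k) (Ms k) (P k) \<Longrightarrow>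
      (frob (Y k - X k))\<^sup>2 + (frob (Z - Y k))\<^sup>2 \<le> (frob (Z - X k))\<^sup>2"
    and V: "V \<in> feasible K Mt Ms P" "V \<noteq> Y"
  shows "(\<Sum>k=1..K. \<eta> k * (frob (Y k - X k))\<^sup>2) < (\<Sum>k=1..K. \<eta> k * (frob (V k - X k))\<^sup>2)"
proof (rule sum_strict_mono_ex1)
  have ball: "V k \<in> power_ball (Mt k) (Ms k) (P k)" "Y k \<in> power_ball (Mt k) (Ms k) (P k)"
    if "k \<in> {1..K}" for k
    using V(1) Y that unfolding feasible_def by (auto dest: PiE_mem)
  show "\<forall>k\<in>{1..K}. \<eta> k * (frob (Y k - X k))\<^sup>2 \<le> \<eta> k * (frob (V k - X k))\<^sup>2"
  proof
    fix k assume k: "k \<in> {1..K}"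
    have "(frob (Y k - X k))\<^sup>2 \<le> (frob (V k - X k))\<^sup>2"
      using gap[OF k ball(1)[OF k]] zero_le_power2[of "frob (V k - Y k)"] by linarith
    then show "\<eta> k * (frob (Y k - X k))\<^sup>2 \<le> \<eta> k * (frob (V k - X k))\<^sup>2"
      using \<eta>[OF k] by simp
  qed
  \<comment> \<open>Extensional families agree outside \<open>{1..K}\<close>, so distinct ones
    differ at some link.\<close>
  obtain k where k: "k \<in> {1..K}" "V k \<noteq> Y k"
    using PiE_ext[OF V(1)[unfolded feasible_def] Y[unfolded feasible_def]] V(2) by blast
  have "frob (V k - Y k) \<noteq> 0"
    using frob_diff_eq_0D[of "V k" "Mt k" "Ms k" "Y k"] ball[OF k(1)] k(2) by (auto simp: power_ball_def)
  then have "0 < (frob (V k - Y k))\<^sup>2" by simp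
  then have "(frob (Y k - X k))\<^sup>2 < (frob (V k - X k))\<^sup>2"
    using gap[OF k(1) ball(1)[OF k(1)]] by linarith
  then show "\<exists>k\<in>{1..K}. \<eta> k * (frob (Y k - X k))\<^sup>2 < \<eta> k * (frob (V k - X k))\<^sup>2"
    using k(1) \<eta>[OF k(1)] by (intro bexI[of _ k]) auto
qed simp

text \<open>One witness \<open>Y\<close>, built from the blockwise projections, solves three
  problems: weights \<open>\<eta>\<close> give the update, weights 1 the joint projection, and each
  block the projection onto its own ball.\<close>

lemma feasible_projection:
  assumes P: "\<And>k. k \<in> {1..K} \<Longrightarrow> 0 < P k"
    and X: "\<And>k. k \<in> {1..K} \<Longrightarrow> X k \<in> carrier_mat (Mt k) (Ms k)"
    and \<eta>: "\<And>k. k \<in> {1..K} \<Longrightarrow> 0 < \<eta> k"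
  shows "\<exists>Y. (\<forall>V. is_arg_min (\<lambda>V. \<Sum>k=1..K. \<eta> k * (frob (V k - X k))\<^sup>2)
        (\<lambda>V. V \<in> feasible K Mt Ms P) V \<longleftrightarrow> V = Y) \<and>
      proj_family K (feasible K Mt Ms P) X = Y \<and>
      (\<forall>k\<in>{1..K}. proj_mat (power_ball (Mt k) (Ms k) (P k)) (X k) = Y k)"
proof -
  have "\<forall>k\<in>{1..K}. \<exists>Y. Y \<in> power_ball (Mt k) (Ms k) (P k) \<and> (\<forall>Z\<in>power_ball (Mt k) (Ms k) (P k).
      (frob (Y - X k))\<^sup>2 + (frob (Z - Y))\<^sup>2 \<le> (frob (Z - X k))\<^sup>2)"
    using power_ball_projection[OF X P] by blast
  then obtain y where y: "\<And>k. k \<in> {1..K} \<Longrightarrow> y k \<in> power_ball (Mt k) (Ms k) (P k)"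
    "\<And>k Z. k \<in> {1..K} \<Longrightarrow> Z \<in> power_ball (Mt k) (Ms k) (P k) \<Longrightarrow>
      (frob (y k - X k))\<^sup>2 + (frob (Z - y k))\<^sup>2 \<le> (frob (Z - X k))\<^sup>2"
    by (metis (no_types, lifting) bchoice)
  \<comment> \<open>Outside \<open>{1..K}\<close> the family must be \<open>undefined\<close> to lie
    in the extensional product.\<close>
  define Y where "Y = restrict y {1..K}"
  have Y: "Y \<in> feasible K Mt Ms P" using y(1) by (auto simp: Y_def feasible_def)
  have gap: "(frob (Y k - X k))\<^sup>2 + (frob (Z - Y k))\<^sup>2 \<le> (frob (Z - X k))\<^sup>2"
    if "k \<in> {1..K}" "Z \<in> power_ball (Mt k) (Ms k) (P k)" for k Z
    using y(2)[OF that] that(1) by (simp add: Y_def)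
  show ?thesis
  proof (intro exI[of _ Y] conjI allI ballI)
    show "is_arg_min (\<lambda>V. \<Sum>k=1..K. \<eta> k * (frob (V k - X k))\<^sup>2)
        (\<lambda>V. V \<in> feasible K Mt Ms P) V \<longleftrightarrow> V = Y" for V
      by (rule is_arg_min_iff_of_gap[where P = "\<lambda>V. V \<in> feasible K Mt Ms P", OF Y])
        (rule feasible_weighted_gap[OF \<eta> Y gap])
    show "proj_family K (feasible K Mt Ms P) X = Y"
      unfolding proj_family_def
    proof (rule arg_min_eqI, rule is_arg_min_iff_of_gap)
      fix V assume V: "V \<in> feasible K Mt Ms P" "V \<noteq> Y"
      show "sqrt (\<Sum>k=1..K. (frob (Y k - X k))\<^sup>2) < sqrt (\<Sum>k=1..K. (frob (V k - X k))\<^sup>2)"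
        using feasible_weighted_gap[of K "\<lambda>_. 1", OF _ Y gap V] by simp
    qed (rule Y)
    fix k assume k: "k \<in> {1..K}"
    show "proj_mat (power_ball (Mt k) (Ms k) (P k)) (X k) = Y k"
      using y(1)[OF k] gap[OF k] k by (intro proj_mat_eq[OF X[OF k]]) (auto simp: Y_def)
  qed
qed

text \<open>A definite description such as \<open>block_gradient\<close> says nothing without
  existence, and a claim about all minimizers is vacuous without one; hence the existence of the
  gradient and of a unique minimizer is part of the conclusion.\<close>

theorem mainTheorem9:
  fixes K :: nat
    and Mr Mt Ms :: "nat \<Rightarrow> nat"
    and H :: "nat \<Rightarrow> nat \<Rightarrow> complex mat"
    and \<sigma> \<omega> P \<eta> :: "nat \<Rightarrow> real"
    and W Q U :: "nat \<Rightarrow> complex mat"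
    and f :: "(nat \<Rightarrow> complex mat) \<Rightarrow> real"
  assumes dims: "\<And>k. k \<in> {1..K} \<Longrightarrow> 0 < Mr k \<and> 0 < Mt k \<and> 0 < Ms k"
    and H: "\<And>i j. i \<in> {1..K} \<Longrightarrow> j \<in> {1..K} \<Longrightarrow> H i j \<in> carrier_mat (Mr i) (Mt j)"
    and \<sigma>: "\<And>k. k \<in> {1..K} \<Longrightarrow> 0 < (\<sigma> k)\<^sup>2"
    and \<omega>: "\<And>k. k \<in> {1..K} \<Longrightarrow> 0 < \<omega> k"
    and P: "\<And>k. k \<in> {1..K} \<Longrightarrow> 0 < P k"
    and W: "W \<in> feasible K Mt Ms P"
    and \<eta>_pos: "\<And>k. k \<in> {1..K} \<Longrightarrow> 0 < \<eta> k"
    and \<eta>_ge: "\<And>k. k \<in> {1..K} \<Longrightarrow> lambda_max (S_mat K Mr Mt H \<sigma> \<omega> W k) \<le> \<eta> k"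
    and f: "f = wsr K Mr Ms H \<sigma> \<omega>"
    and Q: "\<And>k. k \<in> {1..K} \<Longrightarrow>
      Q k = complex_of_real (inverse (\<eta> k)) \<cdot>\<^sub>m
        (complex_of_real (\<omega> k) \<cdot>\<^sub>m ((H k k)\<^sup>H * (B_mat K Mr H \<sigma> W k)\<^sup>H)
          - (S_mat K Mr Mt H \<sigma> \<omega> W k - complex_of_real (\<eta> k) \<cdot>\<^sub>m 1\<^sub>m (Mt k)) * W k)"
    and U: "\<And>k. k \<in> {1..K} \<Longrightarrow>
      U k = W k + complex_of_real (1 / (2 * \<eta> k)) \<cdot>\<^sub>m block_gradient f W k"
  shows "(\<forall>k\<in>{1..K}. has_block_gradient f W k (block_gradient f W k) \<and> Q k = U k) \<and>
    (\<exists>!V. is_arg_min (\<lambda>V. \<Sum>k=1..K. \<eta> k * (frob (V k - Q k))\<^sup>2)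
            (\<lambda>V. V \<in> feasible K Mt Ms P) V) \<and>
    (\<forall>V. is_arg_min (\<lambda>V. \<Sum>k=1..K. \<eta> k * (frob (V k - Q k))\<^sup>2)
            (\<lambda>V. V \<in> feasible K Mt Ms P) V \<longrightarrow>
      V = proj_family K (feasible K Mt Ms P) U \<and>
      (\<forall>k\<in>{1..K}. V k = proj_mat (power_ball (Mt k) (Ms k) (P k)) (U k)))"
proof -
  interpret mimo K Mr Mt Ms H \<sigma>
    by (rule mimo.intro[OF H \<sigma>])
  have Wk: "W k \<in> carrier_mat (Mt k) (Ms k)" if "k \<in> {1..K}" for k
    using PiE_mem[OF W[unfolded feasible_def] that] by (simp add: power_ball_def)
  then have BW: "beamformers W" unfolding beamformers_def by blast
  define L where "L k = complex_of_real (\<omega> k) \<cdot>\<^sub>m ((H k k)\<^sup>H * (B_mat K Mr H \<sigma> W k)\<^sup>H)" for k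
  define S where "S k = S_mat K Mr Mt H \<sigma> \<omega> W k" for k
  have grad: "has_block_gradient f W k (2 \<cdot>\<^sub>m (L k - S k * W k))" if "k \<in> {1..K}" for k
    unfolding f L_def S_def by (rule has_block_gradient_wsr[OF BW that])
  have QU: "Q k = U k" if k: "k \<in> {1..K}" for k
  proof -
    have S: "S k \<in> carrier_mat (Mt k) (Mt k)" by (simp add: S_def S_mat_def)
    have L: "L k \<in> carrier_mat (Mt k) (Ms k)"
      using Wk[OF k] H[OF k k] by (auto simp: L_def B_mat_def F_mat_def)
    have SW: "S k * W k \<in> carrier_mat (Mt k) (Ms k)" using S Wk[OF k] by auto
    have "(S k - complex_of_real (\<eta> k) \<cdot>\<^sub>m 1\<^sub>m (Mt k)) * W k = S k * W k - complex_of_real (\<eta> k) \<cdot>\<^sub>m W k"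
      using minus_mult_distrib_mat[OF S _ Wk[OF k], of "complex_of_real (\<eta> k) \<cdot>\<^sub>m 1\<^sub>m (Mt k)"]
        mult_smult_assoc_mat[OF one_carrier_mat Wk[OF k]] Wk[OF k] by simp
    then have Qk: "Q k = complex_of_real (inverse (\<eta> k)) \<cdot>\<^sub>m (L k - (S k * W k - complex_of_real (\<eta> k) \<cdot>\<^sub>m W k))"
      using Q[OF k] by (simp add: L_def S_def)
    \<comment> \<open>The summand \<open>\<eta> k\<close> times \<open>W k\<close> becomes
      \<open>W k\<close> after division by \<open>\<eta> k\<close>, and the 2 of the gradient
      cancels against the step size.\<close>
    have "Q k = W k + complex_of_real (1 / (2 * \<eta> k)) \<cdot>\<^sub>m (2 \<cdot>\<^sub>m (L k - S k * W k))"
      unfolding Qk using L SW Wk[OF k] \<eta>_pos[OF k]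
      by (intro eq_matI) (auto simp: field_simps simp del: index_mult_mat(1))
    then show ?thesis
      by (simp add: U[OF k] block_gradient_eq[OF grad[OF k]])
  qed
  have Uk: "U k \<in> carrier_mat (Mt k) (Ms k)" if k: "k \<in> {1..K}" for k
    using grad[OF k] Wk[OF k] unfolding U[OF k] block_gradient_eq[OF grad[OF k]]
    by (auto simp: has_block_gradient_def)
  \<comment> \<open>Only the blocks in \<open>{1..K}\<close> enter the objective, and there
    \<open>Q\<close> and \<open>U\<close> agree.\<close>
  have "(\<lambda>V. \<Sum>k=1..K. \<eta> k * (frob (V k - Q k))\<^sup>2) = (\<lambda>V. \<Sum>k=1..K. \<eta> k * (frob (V k - U k))\<^sup>2)"
    by (simp add: QU)
  moreover have "\<exists>Y. (\<forall>V. is_arg_min (\<lambda>V. \<Sum>k=1..K. \<eta> k * (frob (V k - U k))\<^sup>2)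
        (\<lambda>V. V \<in> feasible K Mt Ms P) V \<longleftrightarrow> V = Y) \<and>
      proj_family K (feasible K Mt Ms P) U = Y \<and>
      (\<forall>k\<in>{1..K}. proj_mat (power_ball (Mt k) (Ms k) (P k)) (U k) = Y k)"
    by (rule feasible_projection) (rule P Uk \<eta>_pos, assumption)+
  moreover have "has_block_gradient f W k (block_gradient f W k)" if "k \<in> {1..K}" for k
    using grad[OF that] unfolding block_gradient_eq[OF grad[OF that]] .
  ultimately show ?thesis
    using QU by auto
qed

end
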